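(* Assume that $w>0$ in a neighborhood of $0$, that there is a constant $K_\rho$ with $w*\rho(x)\le K_\rho\,\rho(x)$ for all $x\in\mathbb{R}$, that for all $v\in L^2(\rho)$ one has $\partial_x(w*v)=w_x*v$, and that $$M:=\sup_{x\in\mathbb{R}}\int_{x-\mathcal{S}}\Big(\frac{w_x(x-y)}{w(x-y)}\Big)^2p_0(x,y)\,dy<\infty .$$ Assume further that there exist $\alpha,\beta,k,l>0$ such that for all $x\ge0$, $y\ge0$, $$\mu(x+y)\le k\,e^{-\alpha y}\mu(x),\qquad \mu(-x-y)\le l\,e^{-\beta y}\mu(-x),$$ and that $$\Big\|\frac{\hat u_{xxx}}{\hat u_x}\Big\|_\infty+\Big\|\frac{\hat u_{xx}}{\hat u_x}\Big\|_\infty+\Big\|\frac{\psi_{xx}}{\psi}\Big\|_\infty+\Big\|\frac{\psi_x}{\psi}\Big\|_\infty<\infty .$$ Then: (i) there exist $\delta_1,\delta_2,\delta_1^*,\delta_2^*>0$ such that $\delta_1\hat u_x\le P\hat u_x\le\delta_2\hat u_x$ and $\delta_1^*\psi\le P^*\psi\le\delta_2^*\psi$ on $\mathbb{R}$; (ii) there exists $\kappa_0>0$ such that for all $h\in H^1(\mu)$, $\operatorname{Var}_\mu(h)\le\kappa_0\int h_x^2(x)\,\mu(dx)$.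
   Context: Notation. For a continuous density $\mu:\mathbb{R}\to(0,\infty)$, $H^k(\mu)$ is the weighted Sobolev space of $k$-times weakly differentiable functions with inner product $\langle u,v\rangle_{H^k(\mu)}=\sum_{i=0}^k\int u^{(i)}v^{(i)}\mu\,dx$; $L^2(\mu)=H^0(\mu)$; $H^k$, $L^2$, $\langle\cdot,\cdot\rangle$ are the unweighted ($\mu\equiv1$) versions. $w*h(x)=\int w(x-y)h(y)\,dy$. $\operatorname{Var}_\mu(h)=\int h^2d\mu-(\int h\,d\mu)^2$ for a probability measure $\mu$; a probability density and the corresponding measure are denoted by the same symbol. Standing assumptions. $c\in\mathbb{R}$, $d\ge0$; $f,r,q\in C(\mathbb{R})$ are bounded, with $\inf_{\mathbb R} r>0$ and $\inf_{\mathbb R} q>0$; $w\ge0$ is differentiable almost everywhere (derivative $w_x$), $\int w\,dx=1$ and $\int|w_x|\,dx<\infty$. $\mathcal{S}=\{x\in\mathbb{R}:w(x)>0\}$ and $x-\mathcal{S}=\{x-s:s\in\mathcal{S}\}$. Operators. $L^{\#}v=Av+Pv$, where $Av=-fv+c\,\partial_xv+d\,\partial_{xx}v$ and $Pv(x)=\int p(x,y)v(y)\,dy$ with $p(x,y)=r(x)w(x-y)q(y)$; its domain in $L^2$ is $H^2$ ($H^1$ if $d=0$). The adjoint is $L^{\#,*}v=A^*v+P^*v$, where $A^*v=-fv-c\,\partial_xv+d\,\partial_{xx}v$ and $P^*v(x)=\int p(y,x)v(y)\,dy$. It is assumed that there exist a unique (up to constant multiples) $0\not\equiv\hat u_x\in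 H^2$ with $L^{\#}\hat u_x=0$ and a unique (up to constant multiples) $0\not\equiv\psi\in H^2$ with $L^{\#,*}\psi=0$, and that $\hat u_x>0$ and $\psi>0$. Here $\hat u_x$ is the name of this function, and $\hat u_{xx},\hat u_{xxx}$ denote its first and second derivatives. $\psi$ is normalized so that $\langle\hat u_x,\psi\rangle=1$. Set $\rho(x)=\psi(x)/\hat u_x(x)$. Further definitions: $$p_0(x,y)=\frac{p(x,y)\hat u_x(y)}{P\hat u_x(x)}=\frac{w(x-y)q(y)\hat u_x(y)}{w*(q\hat u_x)(x)},\qquad \mu(x)=\frac1{Z_\mu}P\hat u_x(x)\,\psi(x),\qquad Z_\mu=\int P\hat u_x(x)\,\psi(x)\,dx .$$ *)

theory Defs
  imports "HOL-Analysis.Analysis" "HOL-Probability.Essential_Supremum"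
begin

text \<open>
  Elements of the function spaces below are functions rather than a.e. classes; apart from test
  functions, changing a function on a Lebesgue null set does not affect whether \<open>has_weak_deriv\<close>,
  \<open>weighted_L2\<close> and \<open>weighted_sobolev\<close> hold.
\<close>

definition test_function :: "(real \<Rightarrow> real) \<Rightarrow> bool" where
  "test_function \<phi> \<longleftrightarrow>
     (\<forall>n x. (deriv ^^ n) \<phi> differentiable (at x)) \<and> compact (closure {x. \<phi> x \<noteq> 0})"

definition locally_integrable :: "(real \<Rightarrow> real) \<Rightarrow> bool" where
  "locally_integrable u \<longleftrightarrow> (\<forall>a b. u absolutely_integrable_on {a..b})"

definition has_weak_deriv :: "(real \<Rightarrow> real) \<Rightarrow> (real \<Rightarrow> real) \<Rightarrow> bool" where
  "has_weak_deriv u v \<longleftrightarrow>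
     locally_integrable u \<and> locally_integrable v \<and>
     (\<forall>\<phi>. test_function \<phi> \<longrightarrow>
        (LINT x|lebesgue. u x * deriv \<phi> x) = - (LINT x|lebesgue. v x * \<phi> x))"

text \<open>
  Only determined up to null sets (and meaningless if \<open>u\<close> has no weak derivative), so it may only
  be used inside integrals, essential suprema and a.e. statements.
\<close>
definition weak_deriv :: "(real \<Rightarrow> real) \<Rightarrow> real \<Rightarrow> real" where
  "weak_deriv u = (SOME v. has_weak_deriv u v)"

definition weighted_measure :: "(real \<Rightarrow> real) \<Rightarrow> real measure" where
  "weighted_measure m = density lebesgue (\<lambda>x. ennreal (m x))"

definition weighted_L2 :: "(real \<Rightarrow> real) \<Rightarrow> (real \<Rightarrow> real) \<Rightarrow> bool" where
  "weighted_L2 m u \<longleftrightarrow>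
     u \<in> borel_measurable lebesgue \<and> integrable (weighted_measure m) (\<lambda>x. (u x)\<^sup>2)"

definition weighted_sobolev :: "nat \<Rightarrow> (real \<Rightarrow> real) \<Rightarrow> (real \<Rightarrow> real) \<Rightarrow> bool" where
  "weighted_sobolev k m u \<longleftrightarrow>
     (\<forall>i<k. \<exists>v. has_weak_deriv ((weak_deriv ^^ i) u) v) \<and>
     (\<forall>i\<le>k. weighted_L2 m ((weak_deriv ^^ i) u))"

abbreviation sobolev :: "nat \<Rightarrow> (real \<Rightarrow> real) \<Rightarrow> bool" where
  "sobolev k \<equiv> weighted_sobolev k (\<lambda>_. 1)"

definition Linf_norm :: "(real \<Rightarrow> real) \<Rightarrow> ennreal" where
  "Linf_norm g = esssup lebesgue (\<lambda>x. ennreal \<bar>g x\<bar>)"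

definition Var :: "(real \<Rightarrow> real) \<Rightarrow> (real \<Rightarrow> real) \<Rightarrow> real" where
  "Var m h = (LINT x|weighted_measure m. (h x)\<^sup>2) - (LINT x|weighted_measure m. h x)\<^sup>2"

definition conv :: "(real \<Rightarrow> real) \<Rightarrow> (real \<Rightarrow> real) \<Rightarrow> real \<Rightarrow> real" where
  "conv w h x = (LINT y|lebesgue. w (x - y) * h y)"

text \<open>The Bochner integral of a non-integrable function is \<open>0\<close>, so that the existence of a
  convolution has to be asserted separately.\<close>
definition conv_exists :: "(real \<Rightarrow> real) \<Rightarrow> (real \<Rightarrow> real) \<Rightarrow> real \<Rightarrow> bool" where
  "conv_exists w h x \<longleftrightarrow> integrable lebesgue (\<lambda>y. w (x - y) * h y)"

definition p_kernel ::
  "(real \<Rightarrow> real) \<Rightarrow> (real \<Rightarrow> real) \<Rightarrow> (real \<Rightarrow> real) \<Rightarrow> real \<Rightarrow> real \<Rightarrow> real" where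
  "p_kernel r q w x y = r x * w (x - y) * q y"

definition P_op ::
  "(real \<Rightarrow> real) \<Rightarrow> (real \<Rightarrow> real) \<Rightarrow> (real \<Rightarrow> real) \<Rightarrow> (real \<Rightarrow> real) \<Rightarrow> real \<Rightarrow> real" where
  "P_op r q w v x = (LINT y|lebesgue. p_kernel r q w x y * v y)"

definition P_adj ::
  "(real \<Rightarrow> real) \<Rightarrow> (real \<Rightarrow> real) \<Rightarrow> (real \<Rightarrow> real) \<Rightarrow> (real \<Rightarrow> real) \<Rightarrow> real \<Rightarrow> real" where
  "P_adj r q w v x = (LINT y|lebesgue. p_kernel r q w y x * v y)"

definition A_op :: "real \<Rightarrow> real \<Rightarrow> (real \<Rightarrow> real) \<Rightarrow> (real \<Rightarrow> real) \<Rightarrow> real \<Rightarrow> real" where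
  "A_op c d f v x = - f x * v x + c * weak_deriv v x + d * weak_deriv (weak_deriv v) x"

definition A_adj :: "real \<Rightarrow> real \<Rightarrow> (real \<Rightarrow> real) \<Rightarrow> (real \<Rightarrow> real) \<Rightarrow> real \<Rightarrow> real" where
  "A_adj c d f v x = - f x * v x - c * weak_deriv v x + d * weak_deriv (weak_deriv v) x"

definition L_op :: "real \<Rightarrow> real \<Rightarrow> (real \<Rightarrow> real) \<Rightarrow> (real \<Rightarrow> real) \<Rightarrow> (real \<Rightarrow> real) \<Rightarrow>
    (real \<Rightarrow> real) \<Rightarrow> (real \<Rightarrow> real) \<Rightarrow> real \<Rightarrow> real" where
  "L_op c d f r q w v x = A_op c d f v x + P_op r q w v x"

definition L_adj :: "real \<Rightarrow> real \<Rightarrow> (real \<Rightarrow> real) \<Rightarrow> (real \<Rightarrow> real) \<Rightarrow> (real \<Rightarrow> real) \<Rightarrow>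
    (real \<Rightarrow> real) \<Rightarrow> (real \<Rightarrow> real) \<Rightarrow> real \<Rightarrow> real" where
  "L_adj c d f r q w v x = A_adj c d f v x + P_adj r q w v x"

text \<open>\<open>u\<close> is, up to constant multiples, the unique nonzero element of \<open>H\<^sup>2\<close> annihilated by
  \<open>T\<close>; equations between elements of \<open>L\<^sup>2\<close> are a.e. equations.\<close>

definition nonzero_null_vector ::
  "((real \<Rightarrow> real) \<Rightarrow> real \<Rightarrow> real) \<Rightarrow> (real \<Rightarrow> real) \<Rightarrow> bool" where
  "nonzero_null_vector T u \<longleftrightarrow>
     sobolev 2 u \<and> \<not> (AE x in lebesgue. u x = 0) \<and> (AE x in lebesgue. T u x = 0)"

definition unique_null_vector ::
  "((real \<Rightarrow> real) \<Rightarrow> real \<Rightarrow> real) \<Rightarrow> (real \<Rightarrow> real) \<Rightarrow> bool" where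
  "unique_null_vector T u \<longleftrightarrow>
     nonzero_null_vector T u \<and>
     (\<forall>v. nonzero_null_vector T v \<longrightarrow> (\<exists>a. AE x in lebesgue. v x = a * u x))"

text \<open>Below, \<open>ux\<close> is the null vector of \<open>L_op\<close> itself, not a derivative of some given \<open>u\<close>.
  It and \<open>\<psi>\<close> enter pointwise, so they have to be continuous representatives.\<close>

definition rho :: "(real \<Rightarrow> real) \<Rightarrow> (real \<Rightarrow> real) \<Rightarrow> real \<Rightarrow> real" where
  "rho ux \<psi> x = \<psi> x / ux x"

definition p0 :: "(real \<Rightarrow> real) \<Rightarrow> (real \<Rightarrow> real) \<Rightarrow> (real \<Rightarrow> real) \<Rightarrow> (real \<Rightarrow> real) \<Rightarrow>
    real \<Rightarrow> real \<Rightarrow> real" where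
  "p0 r q w ux x y = p_kernel r q w x y * ux y / P_op r q w ux x"

definition Z_mu :: "(real \<Rightarrow> real) \<Rightarrow> (real \<Rightarrow> real) \<Rightarrow> (real \<Rightarrow> real) \<Rightarrow> (real \<Rightarrow> real) \<Rightarrow>
    (real \<Rightarrow> real) \<Rightarrow> real" where
  "Z_mu r q w ux \<psi> = (LINT x|lebesgue. P_op r q w ux x * \<psi> x)"

definition mu :: "(real \<Rightarrow> real) \<Rightarrow> (real \<Rightarrow> real) \<Rightarrow> (real \<Rightarrow> real) \<Rightarrow> (real \<Rightarrow> real) \<Rightarrow>
    (real \<Rightarrow> real) \<Rightarrow> real \<Rightarrow> real" where
  "mu r q w ux \<psi> x = 1 / Z_mu r q w ux \<psi> * (P_op r q w ux x * \<psi> x)"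

definition pos_set :: "(real \<Rightarrow> real) \<Rightarrow> real set" where
  "pos_set w = {x. w x > 0}"

text \<open>\<open>deriv w\<close> is used where \<open>w\<close> is only a.e. differentiable; its values on the exceptional null
  set are arbitrary and do not affect the integral.\<close>
definition M_const :: "(real \<Rightarrow> real) \<Rightarrow> (real \<Rightarrow> real) \<Rightarrow> (real \<Rightarrow> real) \<Rightarrow> (real \<Rightarrow> real) \<Rightarrow> ennreal"
  where
  "M_const r q w ux =
     (SUP x. \<integral>\<^sup>+ y \<in> (\<lambda>s. x - s) ` pos_set w.
               ennreal ((deriv w (x - y) / w (x - y))\<^sup>2 * p0 r q w ux x y) \<partial>lebesgue)"

end

theory Submission
  imports Defs "HOL-Probability.Probability_Measure" "HOL-Computational_Algebra.Polynomial"
    "HOL-Real_Asymp.Real_Asymp"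
begin

text \<open>
  Both parts rest on the fact that a function on the line with a weak derivative agrees almost
  everywhere with a primitive of that derivative (\<open>weak_deriv_ftc\<close>, \<open>weak_deriv_primitive\<close>). This
  follows by testing with piecewise linear functions that rise over one short interval and fall over
  another. Such functions are limits of
  smooth ones, and Lebesgue's differentiation theorem recovers the values of the function as the
  intervals shrink.

  For part (i), the bounds on the logarithmic derivatives make \<open>ux\<close> comparable to a constant on all
  intervals of a fixed small length (\<open>weak_deriv_local_harnack\<close>), and hence bounded, since it is
  square integrable. So \<open>P ux\<close> is a convolution of an integrable and a bounded continuous function and
  is continuous. The equation \<open>P ux = f ux - c ux' - d ux''\<close> bounds it by a multiple of \<open>ux\<close>,
  almost everywhere and by continuity everywhere. From below, \<open>P ux x\<close> is at least the part of the
  convolution integral near \<open>x\<close>, where the kernel is positive and \<open>ux\<close> is comparable to its value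
  at \<open>x\<close>. The adjoint has the same form with \<open>r\<close> and \<open>q\<close> exchanged and \<open>w\<close>
  reflected, so \<open>P_op_null_vector_comparable\<close> serves \<open>ux\<close> and \<open>\<psi>\<close> alike.

  For part (ii), write \<open>h\<close> as a constant plus the integral of its weak derivative from \<open>0\<close>. The variance is
  at most the second moment about that constant, and on each half-line this moment is controlled by
  a Hardy inequality. Its proof is Cauchy--Schwarz with an exponential weight growing at half the
  decay rate of \<open>\<mu>\<close>, followed by Tonelli (\<open>hardy_exponential_decay\<close>): the decay of \<open>\<mu>\<close> absorbs the
  weight. Part (i) enters through the continuity and positivity of \<open>P ux\<close> and through the finiteness
  and positivity of \<open>Z\<^sub>\<mu>\<close>, which make \<open>\<mu>\<close> a probability density.
\<close>

section \<open>Smooth cutoff functions\<close>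

text \<open>
  The classical smooth function \<open>exp (- 1/x)\<close> on the positive half-line, extended by zero. The
  polynomial factor is there because differentiation produces one: the family of all \<open>flat p\<close> is
  closed under derivatives.
\<close>
definition flat :: "real poly \<Rightarrow> real \<Rightarrow> real" where
  "flat p x = (if x > 0 then poly p (1 / x) * exp (- (1 / x)) else 0)"

lemma poly_mult_exp_minus_tendsto_0:
  "((\<lambda>t. poly p t * exp (- t)) \<longlongrightarrow> (0::real)) at_top"
proof -
  have "((\<lambda>t. \<Sum>i\<le>degree p. coeff p i * (t ^ i / exp t)) \<longlongrightarrow> (\<Sum>i\<le>degree p. coeff p i * 0)) at_top"
    by (intro tendsto_sum tendsto_mult tendsto_const tendsto_power_div_exp_0)
  then show ?thesis
    by (simp add: poly_altdef sum_distrib_right sum_divide_distrib exp_minus field_simps)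
qed

text \<open>
  Away from \<open>0\<close> this is calculus; at \<open>0\<close> the difference quotient is again of the form
  polynomial in \<open>1/h\<close> times \<open>exp (- 1/h)\<close>, and the exponential wins.
\<close>
lemma flat_has_derivative:
  "(flat p has_real_derivative flat (monom 1 2 * (p - pderiv p)) x) (at x)"
proof -
  consider "x < 0" | "x = 0" | "x > 0" by linarith
  then show ?thesis
  proof cases
    case 1
    have "((\<lambda>_. 0) has_real_derivative 0) (at x)" by simp
    moreover have "\<forall>\<^sub>F y in nhds x. flat p y = 0"
      using eventually_nhds_in_open[of "{..<0}" x] 1 by (auto elim!: eventually_mono simp: flat_def)
    ultimately show ?thesis
      using 1 by (subst DERIV_cong_ev[OF refl _ refl, of _ "\<lambda>_. 0"]) (auto simp: flat_def)
  next
    case 3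
    have "((\<lambda>y. poly p (1 / y) * exp (- (1 / y))) has_real_derivative
            (poly (pderiv p) (1 / x) * (- (1 / x\<^sup>2))) * exp (- (1 / x))
            + poly p (1 / x) * (exp (- (1 / x)) * (1 / x\<^sup>2))) (at x)"
      using 3 by (auto intro!: derivative_eq_intros simp: power2_eq_square field_simps)
    also have "(poly (pderiv p) (1 / x) * (- (1 / x\<^sup>2))) * exp (- (1 / x))
            + poly p (1 / x) * (exp (- (1 / x)) * (1 / x\<^sup>2)) = flat (monom 1 2 * (p - pderiv p)) x"
      using 3 by (simp add: flat_def poly_monom power_divide field_simps)
    finally have *: "((\<lambda>y. poly p (1 / y) * exp (- (1 / y))) has_real_derivative
            flat (monom 1 2 * (p - pderiv p)) x) (at x)" .
    moreover have "\<forall>\<^sub>F y in nhds x. flat p y = poly p (1 / y) * exp (- (1 / y))"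
      using eventually_nhds_in_open[of "{0<..}" x] 3 by (auto elim!: eventually_mono simp: flat_def)
    ultimately show ?thesis
      by (subst DERIV_cong_ev[OF refl _ refl])
  next
    case 2
    have "((\<lambda>h. poly (pCons 0 p) (inverse h) * exp (- inverse h)) \<longlongrightarrow> 0) (at_right 0)"
      by (rule filterlim_compose[OF poly_mult_exp_minus_tendsto_0 filterlim_inverse_at_top_right])
    then have "((\<lambda>h. flat p h / h) \<longlongrightarrow> 0) (at_right 0)"
      by (rule Lim_transform_eventually)
        (auto simp: eventually_at_filter flat_def field_simps)
    moreover have "((\<lambda>h. flat p h / h) \<longlongrightarrow> 0) (at_left 0)"
      by (rule Lim_transform_eventually[OF tendsto_const])
        (auto simp: eventually_at_filter flat_def)
    ultimately have "((\<lambda>h. flat p h / h) \<longlongrightarrow> 0) (at 0)"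
      by (simp add: filterlim_split_at_real)
    then show ?thesis
      using 2 by (simp add: DERIV_def flat_def)
  qed
qed

text \<open>
  Smoothness is quantified over the iterates of \<open>deriv\<close>, for which a product rule would be
  awkward. Membership in a class that contains a derivative of each of its members avoids it.
\<close>
lemma derivative_closed_imp_smooth:
  assumes C: "\<And>f. f \<in> C \<Longrightarrow> \<exists>g\<in>C. \<forall>x. (f has_real_derivative g x) (at x)" and "f \<in> C"
  shows "(deriv ^^ n) f differentiable (at (x::real))"
  using \<open>f \<in> C\<close>
proof (induction n arbitrary: f)
  case 0
  then show ?case
    using C by (force simp: real_differentiable_def)
next
  case (Suc n)
  from C[OF Suc.prems] obtain g where g: "g \<in> C" "\<And>x. (f has_real_derivative g x) (at x)" by auto
  then have "deriv f = g" by (auto intro!: ext DERIV_imp_deriv)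
  then show ?case
    using Suc.IH[OF g(1)] by (simp add: funpow_swap1)
qed

text \<open>
  A derivative-closed class that contains the compactly supported bumps: by the product rule the
  derivative of a generator is a sum of two generators.
\<close>
inductive_set cutoffs :: "(real \<Rightarrow> real) set" where
  basic: "(\<lambda>x. flat p (m * (x - a)) * flat q (m * (b - x))) \<in> cutoffs"
| add: "f \<in> cutoffs \<Longrightarrow> g \<in> cutoffs \<Longrightarrow> (\<lambda>x. f x + g x) \<in> cutoffs"

lemma flat_smult: "flat (smult c p) x = c * flat p x"
  by (simp add: flat_def)

lemma cutoffs_derivative:
  assumes "f \<in> cutoffs"
  shows "\<exists>g\<in>cutoffs. \<forall>x. (f has_real_derivative g x) (at x)"
  using assms
proof induction
  case (basic p m a q b)
  let ?p = "monom 1 2 * (p - pderiv p)" and ?q = "monom 1 2 * (q - pderiv q)"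
  let ?g = "\<lambda>x. flat (smult m ?p) (m * (x - a)) * flat q (m * (b - x))
          + flat (smult (- m) p) (m * (x - a)) * flat ?q (m * (b - x))"
  have "?g \<in> cutoffs" by (intro cutoffs.intros)
  moreover have "((\<lambda>x. flat p (m * (x - a)) * flat q (m * (b - x))) has_real_derivative ?g x) (at x)" for x
    unfolding flat_smult
    by (rule derivative_eq_intros DERIV_chain2[OF flat_has_derivative] refl)+ (simp add: algebra_simps)
  ultimately show ?case by (intro bexI[of _ ?g] allI)
next
  case (add f g)
  then obtain f' g' where "f' \<in> cutoffs" "\<forall>x. (f has_real_derivative f' x) (at x)"
     "g' \<in> cutoffs" "\<forall>x. (g has_real_derivative g' x) (at x)" by blast
  then show ?case
    by (intro bexI[of _ "\<lambda>x. f' x + g' x"]) (auto intro!: cutoffs.intros derivative_eq_intros)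
qed

text \<open>
  A smooth approximation, as \<open>m\<close> tends to infinity, of the indicator function of \<open>{a<..<b}\<close>.
\<close>
definition plateau :: "real \<Rightarrow> real \<Rightarrow> real \<Rightarrow> real \<Rightarrow> real" where
  "plateau m a b x = flat 1 (m * (x - a)) * flat 1 (m * (b - x))"

text \<open>
  The primitive of \<open>plateau\<close> that vanishes to the left of \<open>a\<close>. Starting the integral at
  \<open>a - 1\<close> instead of \<open>a\<close> does not change its value and makes \<open>a\<close> an interior point, where the
  fundamental theorem of calculus gives a two-sided derivative.
\<close>
definition ramp :: "real \<Rightarrow> real \<Rightarrow> real \<Rightarrow> real \<Rightarrow> real" where
  "ramp m a b x = integral {a - 1..x} (plateau m a b)"

lemma flat_1_bounds: "0 \<le> flat 1 x" "flat 1 x \<le> 1"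
  by (auto simp: flat_def)

lemma plateau_bounds: "0 \<le> plateau m a b x" "plateau m a b x \<le> 1"
  by (auto simp: plateau_def flat_1_bounds intro: mult_le_one)

lemma plateau_eq_0: "m > 0 \<Longrightarrow> x \<notin> {a<..<b} \<Longrightarrow> plateau m a b x = 0"
  by (auto simp: plateau_def flat_def zero_less_mult_iff)

lemma plateau_cutoff: "plateau m a b \<in> cutoffs"
  unfolding plateau_def[abs_def] by (rule cutoffs.basic)

lemma plateau_continuous: "continuous_on A (plateau m a b)"
  using cutoffs_derivative[OF plateau_cutoff] by (metis DERIV_isCont continuous_at_imp_continuous_on)

lemma plateau_integrable: "plateau m a b integrable_on {c..e}"
  by (intro integrable_continuous_real plateau_continuous)

lemma plateau_tendsto:
  "(\<lambda>n. plateau (real (Suc n)) a b x) \<longlonglongrightarrow> indicator {a<..<b} x"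
proof -
  have *: "(\<lambda>n. flat 1 (real (Suc n) * y)) \<longlonglongrightarrow> (if y > 0 then 1 else 0)" for y
  proof (cases "y > 0")
    case True
    have "(\<lambda>n. exp (- (inverse (real (Suc n)) * inverse y))) \<longlonglongrightarrow> exp (- (0 * inverse y))"
      by (intro tendsto_intros LIMSEQ_inverse_real_of_nat)
    then show ?thesis using True by (simp add: flat_def field_simps zero_less_mult_iff add_pos_pos add_pos_nonneg)
  next
    case False
    then show ?thesis by (simp add: flat_def zero_less_mult_iff del: of_nat_Suc)
  qed
  have "(\<lambda>n. plateau (real (Suc n)) a b x) \<longlonglongrightarrow> (if x - a > 0 then 1 else 0) * (if b - x > 0 then 1 else 0)"
    unfolding plateau_def by (intro tendsto_mult *)
  then show ?thesis by (simp add: indicator_def split: if_splits)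
qed

lemma ramp_eq_0: "m > 0 \<Longrightarrow> x \<le> a \<Longrightarrow> ramp m a b x = 0"
  unfolding ramp_def by (intro integral_unique has_integral_is_0) (auto intro!: plateau_eq_0)

lemma ramp_eq_const:
  assumes "m > 0" "a < b" "b \<le> x" shows "ramp m a b x = ramp m a b b"
proof -
  have "integral {b..x} (plateau m a b) = 0"
    using assms by (intro integral_unique has_integral_is_0) (auto intro!: plateau_eq_0)
  then show ?thesis
    using Henstock_Kurzweil_Integration.integral_combine[OF _ _ plateau_integrable, of "a - 1" b x m a b] assms
    by (simp add: ramp_def)
qed

lemma ramp_has_derivative:
  assumes "m > 0"
  shows "(ramp m a b has_real_derivative plateau m a b x) (at x)"
proof (cases "x < a")
  case True
  have "((\<lambda>_. 0) has_real_derivative 0) (at x)" by simp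
  moreover have "\<forall>\<^sub>F y in nhds x. ramp m a b y = 0"
    using eventually_nhds_in_open[of "{..<a}" x] True assms by (auto elim!: eventually_mono simp: ramp_eq_0)
  ultimately show ?thesis
    using True assms by (subst DERIV_cong_ev[OF refl _ refl, of _ "\<lambda>_. 0"]) (auto simp: plateau_eq_0)
next
  case False
  have "(ramp m a b has_real_derivative plateau m a b x) (at x within {a - 1..x + 1})"
    unfolding ramp_def[abs_def] using False
    by (intro integral_has_real_derivative plateau_continuous) auto
  then show ?thesis
    using False by (subst (asm) at_within_interior) auto
qed

lemma ramp_nonneg: "0 \<le> ramp m a b x"
  unfolding ramp_def by (intro integral_nonneg plateau_integrable plateau_bounds)

lemma ramp_le:
  assumes "m > 0" "a < b" shows "ramp m a b x \<le> b - a"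
proof -
  have *: "ramp m a b x \<le> b - a" if "a < x" "x \<le> b" for x
  proof -
    have "ramp m a b x = integral {a..x} (plateau m a b)"
      using Henstock_Kurzweil_Integration.integral_combine[OF _ _ plateau_integrable, of "a - 1" a x m a b] that assms
        ramp_eq_0[of m a a b]
      by (simp add: ramp_def)
    also have "\<dots> \<le> integral {a..x} (\<lambda>_. 1)"
      by (intro integral_le plateau_integrable plateau_bounds) auto
    finally show ?thesis using that by simp
  qed
  consider "x \<le> a" | "a < x" "x \<le> b" | "b \<le> x" by linarith
  then show ?thesis
    using * *[of b] assms ramp_eq_const[of m a b x] by cases (auto simp: ramp_eq_0)
qed

lemma ramp_tendsto:
  assumes "a < b"
  shows "(\<lambda>n. ramp (real (Suc n)) a b x) \<longlonglongrightarrow> max 0 (min (b - a) (x - a))"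
proof -
  have *: "(\<lambda>n. ramp (real (Suc n)) a b x) \<longlonglongrightarrow> x - a" if "a < x" "x \<le> b" for x
  proof -
    have "((\<lambda>y. if y \<in> {a..x} then 1 else 0) has_integral (x - a)) {a - 1..x}"
      by (subst has_integral_restrict) (use that has_integral_const_real[of "1::real" a x] in auto)
    then have "(indicator {a<..<b} has_integral (x - a)) {a - 1..x}"
      by (rule has_integral_spike_finite[rotated 2, of _ _ _ "{a, b}"])
         (use that in \<open>auto simp: indicator_def\<close>)
    then have I: "integral {a - 1..x} (indicator {a<..<b}) = x - a" by (rule integral_unique)
    have "(\<lambda>n. integral {a - 1..x} (plateau (real (Suc n)) a b)) \<longlonglongrightarrow> integral {a - 1..x} (indicator {a<..<b})"
      by (rule dominated_convergence(2)[where h="\<lambda>_. 1"])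
         (use plateau_tendsto plateau_bounds in \<open>auto intro!: plateau_integrable simp del: of_nat_Suc\<close>)
    then show ?thesis by (simp add: ramp_def I)
  qed
  consider "x \<le> a" | "a < x" "x \<le> b" | "b \<le> x" by linarith
  then show ?thesis
  proof cases
    case 1
    then show ?thesis using assms by (simp add: ramp_eq_0 del: of_nat_Suc)
  next
    case 3
    then have "(\<lambda>n. ramp (real (Suc n)) a b x) = (\<lambda>n. ramp (real (Suc n)) a b b)"
      using assms by (intro ext ramp_eq_const) auto
    then show ?thesis using *[of b] 3 assms by simp
  qed (use * assms in \<open>simp del: of_nat_Suc\<close>)
qed

lemma ramp_difference_has_derivative:
  assumes "m > 0"
  shows "((\<lambda>x. ramp m a b x - ramp m a b (x - t)) has_real_derivative
           (plateau m a b x - plateau m a b (x - t))) (at x)"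
  by (rule derivative_eq_intros ramp_has_derivative DERIV_chain2[OF ramp_has_derivative] assms refl)+ simp

text \<open>
  A ramp is constant to the right of \<open>b\<close>, so the difference of two translates of the same ramp has
  compact support: to the right of both ramps the same constant cancels.
\<close>
lemma ramp_difference_support:
  assumes "m > 0" "a < b" "t \<ge> 0" "x \<notin> {a..b + t}"
  shows "ramp m a b x - ramp m a b (x - t) = 0"
  using assms ramp_eq_0[of m x a b] ramp_eq_0[of m "x - t" a b] ramp_eq_const[of m a b x] ramp_eq_const[of m a b "x - t"]
  by (cases "x < a") auto

lemma ramp_difference_test_function:
  assumes "m > 0" "a < b" "t \<ge> 0"
  shows "test_function (\<lambda>x. ramp m a b x - ramp m a b (x - t))" (is "test_function ?\<phi>")
  unfolding test_function_def
proof
  let ?g = "\<lambda>x. plateau m a b x - plateau m a b (x - t)"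
  have "?g \<in> cutoffs"
  proof -
    have "(\<lambda>x. flat 1 (m * (x - a)) * flat 1 (m * (b - x))
            + flat (smult (- 1) 1) (m * (x - (a + t))) * flat 1 (m * ((b + t) - x))) \<in> cutoffs"
      by (intro cutoffs.intros)
    then show ?thesis
      unfolding flat_smult plateau_def by (simp add: algebra_simps)
  qed
  then have "\<exists>g\<in>insert ?\<phi> cutoffs. \<forall>x. (f has_real_derivative g x) (at x)"
    if "f \<in> insert ?\<phi> cutoffs" for f
  proof (cases "f = ?\<phi>")
    case True
    then show ?thesis
      using \<open>?g \<in> cutoffs\<close> ramp_difference_has_derivative[OF assms(1), of a b t]
      by (intro bexI[of _ ?g]) auto
  next
    case False
    then show ?thesis using that cutoffs_derivative[of f] by blast
  qed
  from derivative_closed_imp_smooth[OF this] show "\<forall>n x. (deriv ^^ n) ?\<phi> differentiable at x"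
    by blast
  have "closure {x. ?\<phi> x \<noteq> 0} \<subseteq> {a..b + t}"
    using ramp_difference_support[OF assms] by (intro closure_minimal) (blast, simp)
  then show "compact (closure {x. ?\<phi> x \<noteq> 0})"
    using compact_Int_closed[of "{a..b + t}" "closure {x. ?\<phi> x \<noteq> 0}"] by (simp add: Int_absorb1)
qed

section \<open>Weak derivatives on the real line\<close>

lemma continuous_imp_lebesgue_measurable:
  fixes g :: "real \<Rightarrow> real"
  assumes "continuous_on UNIV g"
  shows "g \<in> borel_measurable lebesgue"
  using assms borel_measurable_continuous_onI by (intro measurable_completion) simp

text \<open>
  The defining identity of a weak derivative, for a function whose derivative is the indicator
  of a box at \<open>s\<close> minus the indicator of its translate by \<open>t\<close>. That function is piecewise linear, not
  smooth; it is the limit of differences of smooth ramps, and dominated convergence passes to the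
  limit on both sides.
\<close>
lemma weak_deriv_box_identity:
  assumes uv: "has_weak_deriv u v" and h: "h > 0" and t: "t \<ge> 0"
  shows "(LINT x|lebesgue. u x * (indicator {s<..<s + h} x - indicator {s<..<s + h} (x - t)))
       = - (LINT x|lebesgue. v x * (max 0 (min h (x - s)) - max 0 (min h (x - t - s))))"
proof -
  \<comment> \<open>All test functions below and their derivatives vanish outside \<open>I\<close>, so the locally integrable functions
    \<open>u\<close> and \<open>v\<close> may be replaced by the integrable functions \<open>U\<close> and \<open>V\<close>.\<close>
  define I where "I = {s..s + h + t}"
  define U where "U = (\<lambda>x. indicator I x * u x)"
  define V where "V = (\<lambda>x. indicator I x * v x)"
  have U: "integrable lebesgue U" and V: "integrable lebesgue V"
    using uv by (simp_all add: has_weak_deriv_def locally_integrable_def set_integrable_def U_def V_def I_def)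
  let ?\<phi> = "\<lambda>n x. ramp (real (Suc n)) s (s + h) x - ramp (real (Suc n)) s (s + h) (x - t)"
  let ?\<phi>' = "\<lambda>n x. plateau (real (Suc n)) s (s + h) x - plateau (real (Suc n)) s (s + h) (x - t)"
  let ?i = "\<lambda>x. indicator {s<..<s + h} x - indicator {s<..<s + h} (x - t) :: real"
  let ?r = "\<lambda>x. max 0 (min h (x - s)) - max 0 (min h (x - t - s))"
  have eq: "(LINT x|lebesgue. U x * ?\<phi>' n x) = - (LINT x|lebesgue. V x * ?\<phi> n x)" for n
  proof -
    have d: "deriv (?\<phi> n) = ?\<phi>' n"
      by (intro ext DERIV_imp_deriv ramp_difference_has_derivative) simp
    have "(LINT x|lebesgue. u x * deriv (?\<phi> n) x) = - (LINT x|lebesgue. v x * ?\<phi> n x)"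
      using uv ramp_difference_test_function[of "real (Suc n)" s "s + h" t] h t
      by (auto simp: has_weak_deriv_def)
    also have "(LINT x|lebesgue. u x * deriv (?\<phi> n) x) = (LINT x|lebesgue. U x * ?\<phi>' n x)"
    proof -
      have "?\<phi>' n x = 0" if "x \<notin> I" for x
        using that h t plateau_eq_0[of "real (Suc n)" x s "s + h"] plateau_eq_0[of "real (Suc n)" "x - t" s "s + h"]
        by (auto simp: I_def)
      then show ?thesis
        unfolding d U_def by (intro Bochner_Integration.integral_cong refl) (auto simp: indicator_def)
    qed
    also have "(LINT x|lebesgue. v x * ?\<phi> n x) = (LINT x|lebesgue. V x * ?\<phi> n x)"
      unfolding V_def I_def using h t ramp_difference_support[of "real (Suc n)" s "s + h" t]
      by (intro Bochner_Integration.integral_cong refl) (auto simp: indicator_def)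
    finally show ?thesis .
  qed
  have lim_U: "(\<lambda>n. LINT x|lebesgue. U x * ?\<phi>' n x) \<longlonglongrightarrow> (LINT x|lebesgue. U x * ?i x)"
  proof (rule integral_dominated_convergence)
    show "integrable lebesgue (\<lambda>x. \<bar>U x\<bar>)" using U by simp
    show "(\<lambda>x. U x * ?i x) \<in> borel_measurable lebesgue"
      by (rule borel_measurable_times[OF borel_measurable_integrable[OF U] measurable_completion]) auto
    show "(\<lambda>x. U x * ?\<phi>' n x) \<in> borel_measurable lebesgue" for n
      by (intro borel_measurable_times[OF borel_measurable_integrable[OF U]]
        continuous_imp_lebesgue_measurable continuous_intros plateau_continuous continuous_on_compose2[OF plateau_continuous]) auto
    show "AE x in lebesgue. (\<lambda>n. U x * ?\<phi>' n x) \<longlonglongrightarrow> U x * ?i x"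
      by (intro AE_I2 tendsto_intros plateau_tendsto)
    have "\<bar>?\<phi>' n x\<bar> \<le> 1" for n x
      using plateau_bounds[of "real (Suc n)" s "s + h" x] plateau_bounds[of "real (Suc n)" s "s + h" "x - t"]
      by linarith
    then show "AE x in lebesgue. norm (U x * ?\<phi>' n x) \<le> \<bar>U x\<bar>" for n
      by (intro AE_I2) (simp add: abs_mult mult_left_le)
  qed
  have lim_V: "(\<lambda>n. LINT x|lebesgue. V x * ?\<phi> n x) \<longlonglongrightarrow> (LINT x|lebesgue. V x * ?r x)"
  proof (rule integral_dominated_convergence)
    show "integrable lebesgue (\<lambda>x. \<bar>V x\<bar> * h)" using V by simp
    show "(\<lambda>x. V x * ?r x) \<in> borel_measurable lebesgue"
      by (intro borel_measurable_times[OF borel_measurable_integrable[OF V]]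
        continuous_imp_lebesgue_measurable continuous_intros)
    have "continuous_on UNIV (?\<phi> n)" for n
      by (intro continuous_at_imp_continuous_on ballI DERIV_isCont[OF ramp_difference_has_derivative]) simp
    then show "(\<lambda>x. V x * ?\<phi> n x) \<in> borel_measurable lebesgue" for n
      by (intro borel_measurable_times[OF borel_measurable_integrable[OF V]]
        continuous_imp_lebesgue_measurable)
    show "AE x in lebesgue. (\<lambda>n. V x * ?\<phi> n x) \<longlonglongrightarrow> V x * ?r x"
      using ramp_tendsto[of s "s + h"] h by (intro AE_I2 tendsto_intros) (auto simp del: of_nat_Suc)
    have b: "0 \<le> ramp (real (Suc n)) s (s + h) x" "ramp (real (Suc n)) s (s + h) x \<le> h" for n x
      using ramp_nonneg ramp_le[of "real (Suc n)" s "s + h" x] h by simp_all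
    have "\<bar>?\<phi> n x\<bar> \<le> h" for n x
      using b[of n x] b[of n "x - t"] by linarith
    then show "AE x in lebesgue. norm (V x * ?\<phi> n x) \<le> \<bar>V x\<bar> * h" for n
      by (intro AE_I2) (simp add: abs_mult mult_left_mono)
  qed
  have "(LINT x|lebesgue. U x * ?i x) = - (LINT x|lebesgue. V x * ?r x)"
    by (rule LIMSEQ_unique[OF lim_U]) (unfold eq, rule tendsto_minus[OF lim_V])
  also have "(LINT x|lebesgue. U x * ?i x) = (LINT x|lebesgue. u x * ?i x)"
    unfolding U_def I_def using h t
    by (intro Bochner_Integration.integral_cong refl) (auto simp: indicator_def)
  also have "(LINT x|lebesgue. V x * ?r x) = (LINT x|lebesgue. v x * ?r x)"
    unfolding V_def I_def using h t
    by (intro Bochner_Integration.integral_cong refl) (auto simp: indicator_def)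
  finally show ?thesis .
qed

text \<open>
  Lebesgue points for averages to the right only, along one sequence of lengths: these are the
  averages that the box identity produces.
\<close>
definition right_lebesgue_point :: "(real \<Rightarrow> real) \<Rightarrow> real \<Rightarrow> bool" where
  "right_lebesgue_point u s \<longleftrightarrow>
     (\<lambda>n. real (Suc n) * integral {s..s + 1 / real (Suc n)} u) \<longlonglongrightarrow> u s"

text \<open>
  The passage between integrals over the whole line and Henstock--Kurzweil integrals over a compact
  interval; the set \<open>A\<close> is any of the intervals with endpoints \<open>a\<close> and \<open>b\<close>.
\<close>
lemma locally_integrable_integral:
  assumes "locally_integrable u" "A \<subseteq> {a..b}" "{a<..<b} \<subseteq> A"
  shows "(LINT x|lebesgue. u x * indicator A x) = integral {a..b} u"
    and "integrable lebesgue (\<lambda>x. u x * indicator A x)"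
proof -
  have i: "set_integrable lebesgue {a..b} u"
    using assms by (simp add: locally_integrable_def)
  have m: "A \<in> sets lebesgue"
  proof -
    have "{a<..<b} \<union> (A \<inter> {a, b}) \<in> sets borel"
      by (rule sets.Un[OF borel_open borel_closed[OF finite_imp_closed]]) auto
    moreover have "A = {a<..<b} \<union> (A \<inter> {a, b})" using assms(2,3) by fastforce
    ultimately show ?thesis by simp
  qed
  have e: "AE x in lebesgue. u x * indicator A x = indicator {a..b} x *\<^sub>R u x"
  proof -
    have "AE x in lebesgue. x \<notin> {a, b}"
      by (intro AE_not_in) (auto simp: null_sets_completion_iff finite_imp_null_set_lborel intro: null_sets_completionI)
    then show ?thesis
    proof eventually_elim
      case (elim x)
      then have "x \<in> A \<longleftrightarrow> x \<in> {a..b}"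
        using assms(2,3) less_eq_real_def by fastforce
      then show ?case by (simp add: indicator_def)
    qed
  qed
  have i2: "integrable lebesgue (\<lambda>x. u x * indicator A x)"
  proof -
    have "integrable lebesgue (\<lambda>x. (indicator {a..b} x *\<^sub>R u x) * indicator A x)"
      using i m unfolding set_integrable_def by (intro integrable_real_mult_indicator)
    moreover have "(indicator {a..b} x *\<^sub>R u x) * indicator A x = u x * indicator A x" for x
      using assms(2) by (auto simp: indicator_def)
    ultimately show ?thesis by (simp only:)
  qed
  then show "integrable lebesgue (\<lambda>x. u x * indicator A x)" .
  have "(LINT x|lebesgue. u x * indicator A x) = (LINT x|lebesgue. indicator {a..b} x *\<^sub>R u x)"
    using i2 i e unfolding set_integrable_def by (intro integral_cong_AE) auto
  also have "\<dots> = integral {a..b} u"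
    using set_lebesgue_integral_eq_integral(2)[OF i] by (simp add: set_lebesgue_integral_def)
  finally show "(LINT x|lebesgue. u x * indicator A x) = integral {a..b} u" .
qed

lemma AE_right_lebesgue_point:
  assumes "locally_integrable u"
  shows "AE s in lebesgue. right_lebesgue_point u s"
proof -
  have "u integrable_on cbox a b" for a b
    using assms by (simp add: locally_integrable_def set_lebesgue_integral_eq_integral(1))
  from integrable_ccontinuous_explicit[of u, OF this] obtain N where "negligible N" and
    N: "\<And>x e. \<lbrakk>x \<notin> N; 0 < e\<rbrakk> \<Longrightarrow> \<exists>d>0. \<forall>h. 0 < h \<and> h < d \<longrightarrow>
         norm (integral (cbox x (x + h *\<^sub>R One)) u /\<^sub>R h ^ DIM(real) - u x) < e" by blast
  have "right_lebesgue_point u s" if "s \<notin> N" for s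
    unfolding right_lebesgue_point_def
  proof (rule LIMSEQ_I)
    fix e :: real assume "e > 0"
    from N[OF that this] obtain d where d: "d > 0"
       "\<And>h. 0 < h \<Longrightarrow> h < d \<Longrightarrow> norm (integral {s..s + h} u / h - u s) < e"
      by (auto simp: divide_inverse mult.commute)
    obtain n0 where n0: "1 / real (Suc n0) < d"
      using nat_approx_posE[OF d(1)] by blast
    have "norm (real (Suc n) * integral {s..s + 1 / real (Suc n)} u - u s) < e" if "n \<ge> n0" for n
    proof -
      have "1 / real (Suc n) \<le> 1 / real (Suc n0)" using that by (intro divide_left_mono) auto
      then show ?thesis using d(2)[of "1 / real (Suc n)"] n0 by (simp add: mult.commute del: of_nat_Suc)
    qed
    then show "\<exists>no. \<forall>n\<ge>no. norm (real (Suc n) * integral {s..s + 1 / real (Suc n)} u - u s) < e" by blast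
  qed
  then show ?thesis
    using \<open>negligible N\<close> by (auto simp: eventually_ae_filter negligible_iff_null_sets intro!: bexI[of _ N])
qed

text \<open>
  The fundamental theorem of calculus for weak derivatives. In \<open>weak_deriv_box_identity\<close> let the
  width of the boxes shrink to zero and divide by it: the left-hand side becomes the difference of
  the values of \<open>u\<close> by the Lebesgue point assumption, and on the right the piecewise linear test
  function tends to the indicator of \<open>{s<..t}\<close>.
\<close>
lemma weak_deriv_ftc:
  assumes uv: "has_weak_deriv u v" and "s \<le> t"
    and "right_lebesgue_point u s" "right_lebesgue_point u t"
  shows "u t - u s = integral {s..t} v"
proof -
  have u: "locally_integrable u" and v: "locally_integrable v"
    using uv by (simp_all add: has_weak_deriv_def)
  define h where "h n = 1 / real (Suc n)" for n
  have h: "0 < h n" "h n \<le> 1" for n by (simp_all add: h_def)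
  let ?r = "\<lambda>n z. max 0 (min 1 (z / h n))"
  let ?V = "\<lambda>x. v x * indicator {s..t + 1} x"
  have V: "integrable lebesgue ?V"
    by (rule locally_integrable_integral[OF v]) auto
  have eq: "integral {s..s + h n} u / h n - integral {t..t + h n} u / h n
      = - (LINT x|lebesgue. ?V x * (?r n (x - s) - ?r n (x - t)))" for n
  proof -
    have "integral {s..s + h n} u - integral {t..t + h n} u
      = (LINT x|lebesgue. u x * indicator {s<..<s + h n} x) - (LINT x|lebesgue. u x * indicator {t<..<t + h n} x)"
      by (subst (1 2) locally_integrable_integral(1)[OF u]) auto
    also have "\<dots> = (LINT x|lebesgue. u x * indicator {s<..<s + h n} x - u x * indicator {t<..<t + h n} x)"
      by (intro Bochner_Integration.integral_diff[symmetric] locally_integrable_integral(2)[OF u]) auto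
    also have "\<dots> = (LINT x|lebesgue. u x * (indicator {s<..<s + h n} x - indicator {s<..<s + h n} (x - (t - s))))"
      by (intro Bochner_Integration.integral_cong refl) (auto simp: indicator_def)
    also have "\<dots> = - (LINT x|lebesgue. v x * (max 0 (min (h n) (x - s)) - max 0 (min (h n) (x - (t - s) - s))))"
      using assms h by (intro weak_deriv_box_identity) auto
    also have "(LINT x|lebesgue. v x * (max 0 (min (h n) (x - s)) - max 0 (min (h n) (x - (t - s) - s))))
         = (LINT x|lebesgue. h n * (?V x * (?r n (x - s) - ?r n (x - t))))"
    proof (intro Bochner_Integration.integral_cong refl)
      fix x
      have *: "max 0 (min (h n) z) = h n * ?r n z" for z
        using h[of n] by (auto simp: max_def min_def field_simps)
      have **: "?r n (x - s) - ?r n (x - t) = 0" if "x \<notin> {s..t + 1}"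
        using that h[of n] \<open>s \<le> t\<close> by (auto simp: max_def min_def field_simps)
      show "v x * (max 0 (min (h n) (x - s)) - max 0 (min (h n) (x - (t - s) - s))) =
         h n * (?V x * (?r n (x - s) - ?r n (x - t)))"
      proof (cases "x \<in> {s..t + 1}")
        case True
        then show ?thesis unfolding * by (simp add: algebra_simps)
      next
        case False
        then show ?thesis using **[OF False] unfolding * by (simp add: algebra_simps)
      qed
    qed
    also have "\<dots> = h n * (LINT x|lebesgue. ?V x * (?r n (x - s) - ?r n (x - t)))"
      by (rule Bochner_Integration.integral_mult_right_zero)
    finally show ?thesis using h[of n] by (subst diff_divide_distrib[symmetric]) simp
  qed
  have "(\<lambda>n. LINT x|lebesgue. ?V x * (?r n (x - s) - ?r n (x - t)))
      \<longlonglongrightarrow> (LINT x|lebesgue. ?V x * (indicator {s<..} x - indicator {t<..} x))"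
  proof (rule integral_dominated_convergence)
    show "integrable lebesgue (\<lambda>x. \<bar>?V x\<bar>)" using V by (rule integrable_abs)
    show "(\<lambda>x. ?V x * (indicator {s<..} x - indicator {t<..} x)) \<in> borel_measurable lebesgue"
      by (intro borel_measurable_times[OF borel_measurable_integrable[OF V]]
        measurable_completion[of "\<lambda>x. indicator {s<..} x - indicator {t<..} x"]) auto
    show "(\<lambda>x. ?V x * (?r n (x - s) - ?r n (x - t))) \<in> borel_measurable lebesgue" for n
      using h[of n] by (intro borel_measurable_times[OF borel_measurable_integrable[OF V]]
        continuous_imp_lebesgue_measurable continuous_intros) auto
    have step: "(\<lambda>n. ?r n z) \<longlonglongrightarrow> (if z > 0 then 1 else 0)" for z
    proof (cases "z > 0")
      case True
      have "\<forall>\<^sub>F n in sequentially. 1 \<le> z / h n"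
      proof -
        obtain n0 where n0: "1 / real (Suc n0) < z" using nat_approx_posE[OF True] by blast
        have "1 \<le> z / h n" if "n \<ge> n0" for n
        proof -
          have "h n \<le> 1 / real (Suc n0)" unfolding h_def using that by (intro divide_left_mono) auto
          then show ?thesis using n0 h[of n] by (simp add: le_divide_eq_1)
        qed
        then show ?thesis by (auto simp: eventually_sequentially)
      qed
      then have "\<forall>\<^sub>F n in sequentially. ?r n z = 1" by eventually_elim simp
      then show ?thesis using True by (simp add: tendsto_eventually)
    next
      case False
      then have "z / h n \<le> 0" for n using h[of n] by (simp add: divide_nonpos_pos)
      then have "?r n z = 0" for n
      proof -
        have "max 0 (min 1 y) = 0" if "y \<le> 0" for y :: real using that by auto
        then show ?thesis using \<open>\<And>n. z / h n \<le> 0\<close> by blast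
      qed
      then show ?thesis using False by simp
    qed
    have lim: "(\<lambda>n. ?r n (x - y)) \<longlonglongrightarrow> indicator {y<..} x" for x y
      using step[of "x - y"] by (cases "y < x") simp_all
    show "AE x in lebesgue. (\<lambda>n. ?V x * (?r n (x - s) - ?r n (x - t)))
      \<longlonglongrightarrow> ?V x * (indicator {s<..} x - indicator {t<..} x)"
      by (intro AE_I2 tendsto_mult tendsto_diff tendsto_const lim)
    have b: "\<bar>?r n y - ?r n z\<bar> \<le> 1" for n y z by (auto simp: max_def min_def)
    have "norm (a * c) \<le> \<bar>a\<bar>" if "\<bar>c\<bar> \<le> 1" for a c :: real
      using that by (simp add: abs_mult mult_left_le)
    then show "AE x in lebesgue. norm (?V x * (?r n (x - s) - ?r n (x - t))) \<le> \<bar>?V x\<bar>" for n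
      using b by (intro AE_I2) blast
  qed
  also have "(LINT x|lebesgue. ?V x * (indicator {s<..} x - indicator {t<..} x)) = (LINT x|lebesgue. v x * indicator {s<..t} x)"
    using \<open>s \<le> t\<close> by (intro Bochner_Integration.integral_cong refl) (auto simp: indicator_def)
  also have "\<dots> = integral {s..t} v"
    by (rule locally_integrable_integral(1)[OF v]) auto
  finally have "(\<lambda>n. integral {s..s + h n} u / h n - integral {t..t + h n} u / h n) \<longlonglongrightarrow> - integral {s..t} v"
    unfolding eq by (rule tendsto_minus)
  moreover have "(\<lambda>n. integral {s..s + h n} u / h n - integral {t..t + h n} u / h n) \<longlonglongrightarrow> u s - u t"
    using tendsto_diff[OF assms(3,4)[unfolded right_lebesgue_point_def]]
    by (simp add: h_def mult.commute del: of_nat_Suc)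
  ultimately have "u s - u t = - integral {s..t} v" by (rule LIMSEQ_unique[rotated])
  then show ?thesis by simp
qed

text \<open>
  Almost all points are Lebesgue points, so \<open>u\<close> agrees almost everywhere with a primitive of \<open>v\<close>.
  Of the two integrals one is over an empty or degenerate interval and vanishes; their difference is
  the oriented integral from \<open>0\<close> to \<open>x\<close>.
\<close>
lemma weak_deriv_primitive:
  assumes uv: "has_weak_deriv u v"
  obtains C where "AE x in lebesgue. u x = C + (integral {0..x} v - integral {x..0} v)"
proof -
  define V where "V x = integral {0..x} v - integral {x..0} v" for x
  have i: "v integrable_on {a..b}" for a b
    using uv by (simp add: has_weak_deriv_def locally_integrable_def set_lebesgue_integral_eq_integral(1))
  have degenerate: "integral {a..b} v = 0" if "b \<le> a" for a b
    using that by (cases "a = b") auto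
  have V: "V t - V s = integral {s..t} v" if "s \<le> t" for s t
  proof -
    consider "0 \<le> s" | "s \<le> 0" "0 \<le> t" | "t \<le> 0" by linarith
    then show ?thesis
    proof cases
      case 1
      with that show ?thesis
        using Henstock_Kurzweil_Integration.integral_combine[OF _ _ i, of 0 s t]
        by (simp add: V_def degenerate)
    next
      case 2
      then show ?thesis
        using Henstock_Kurzweil_Integration.integral_combine[OF _ _ i, of s 0 t]
        by (simp add: V_def degenerate)
    next
      case 3
      with that show ?thesis
        using Henstock_Kurzweil_Integration.integral_combine[OF _ _ i, of s t 0]
        by (simp add: V_def degenerate)
    qed
  qed
  have AE: "AE x in lebesgue. right_lebesgue_point u x"
    using uv by (intro AE_right_lebesgue_point) (simp add: has_weak_deriv_def)
  have "\<exists>s. right_lebesgue_point u s"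
  proof (rule ccontr)
    assume "\<nexists>s. right_lebesgue_point u s"
    with AE have "\<exists>N\<in>null_sets lebesgue. (UNIV :: real set) \<subseteq> N"
      by (simp add: eventually_ae_filter)
    then have "negligible (UNIV :: real set)"
      using negligible_iff_null_sets negligible_subset by blast
    then show False using open_not_negligible[of "UNIV :: real set"] by simp
  qed
  then obtain s where s: "right_lebesgue_point u s" by blast
  have "AE x in lebesgue. u x = (u s - V s) + (integral {0..x} v - integral {x..0} v)"
    using AE
  proof eventually_elim
    case (elim x)
    show ?case
    proof (cases "s \<le> x")
      case True
      then show ?thesis using weak_deriv_ftc[OF uv True s elim] V[OF True] by (simp add: V_def)
    next
      case False
      then have "x \<le> s" by simp
      then show ?thesis using weak_deriv_ftc[OF uv _ elim s] V[of x s] by (simp add: V_def)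
    qed
  qed
  then show ?thesis by (rule that)
qed

section \<open>Comparison of a positive null vector with its image under the integral operator\<close>

lemma weighted_sobolev_weak_deriv:
  assumes "weighted_sobolev k m u" "k > 0"
  shows "has_weak_deriv u (weak_deriv u)"
proof -
  have "\<exists>v. has_weak_deriv ((weak_deriv ^^ 0) u) v"
    using assms unfolding weighted_sobolev_def by blast
  then show ?thesis unfolding weak_deriv_def by (simp add: someI_ex)
qed

lemma Linf_norm_bound:
  assumes "Linf_norm g < \<infinity>"
  shows "\<exists>K>0. AE x in lebesgue. \<bar>g x\<bar> \<le> K"
proof (intro exI conjI)
  have "AE x in lebesgue. ennreal \<bar>g x\<bar> \<le> Linf_norm g"
    unfolding Linf_norm_def by (rule esssup_AE)
  then show "AE x in lebesgue. \<bar>g x\<bar> \<le> enn2real (Linf_norm g) + 1"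
  proof eventually_elim
    case (elim x)
    have "\<bar>g x\<bar> \<le> enn2real (Linf_norm g)"
      using enn2real_mono[OF elim] assms by simp
    then show ?case by simp
  qed
qed (simp add: add_nonneg_pos)

text \<open>
  The set where the inequality fails is open, and an open null set is empty.
\<close>
lemma AE_le_imp_le_continuous:
  fixes f g :: "real \<Rightarrow> real"
  assumes "continuous_on UNIV f" "continuous_on UNIV g" "AE x in lebesgue. f x \<le> g x"
  shows "f x \<le> g x"
proof -
  have "open {x. g x < f x}"
    using assms by (intro open_Collect_less) auto
  moreover have "negligible {x. g x < f x}"
    using assms(3) by (simp add: AE_iff_null_sets negligible_iff_null_sets[symmetric] not_le
        eventually_ae_filter Collect_neg_eq[symmetric])
      (metis negligible_iff_null_sets negligible_subset)
  ultimately have "{x. g x < f x} = {}"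
    using open_not_negligible by blast
  then show ?thesis by (auto simp: not_less[symmetric])
qed

lemma continuous_imp_right_lebesgue_point:
  assumes "continuous_on UNIV u"
  shows "right_lebesgue_point u s"
proof -
  have "((\<lambda>x. integral {s..x} u) has_real_derivative u s) (at s within {s..s + 1})"
    by (rule integral_has_real_derivative[OF continuous_on_subset[OF assms]]) auto
  then have lim: "((\<lambda>x. integral {s..x} u / (x - s)) \<longlongrightarrow> u s) (at s within {s..s + 1})"
    by (simp add: has_field_derivative_iff)
  have "filterlim (\<lambda>n. s + 1 / real (Suc n)) (at s within {s..s + 1}) sequentially"
  proof -
    have "(\<lambda>n. s + inverse (real (Suc n))) \<longlonglongrightarrow> s + 0"
      by (intro tendsto_intros LIMSEQ_inverse_real_of_nat)
    moreover have "0 < 1 / real (Suc n)" "1 / real (Suc n) \<le> 1" for n by simp_all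
    ultimately show ?thesis
      unfolding filterlim_at inverse_eq_divide add_0_right
      by (intro conjI always_eventually allI) (simp_all del: of_nat_Suc)
  qed
  from filterlim_compose[OF lim this] show ?thesis
    by (simp add: right_lebesgue_point_def mult.commute del: of_nat_Suc)
qed

text \<open>
  A bound on the logarithmic derivative makes the values at nearby points comparable. On an interval
  of length at most \<open>1 / (2 * K)\<close> the function can fall below its maximum by at most half of that
  maximum.
\<close>
lemma weak_deriv_local_harnack:
  assumes uv: "has_weak_deriv u v" and cont: "continuous_on UNIV u" and pos: "\<And>x. u x > 0"
    and K: "K > 0" "AE x in lebesgue. \<bar>v x\<bar> \<le> K * u x"
    and xy: "\<bar>x - y\<bar> \<le> 1 / (2 * K)"
  shows "u x \<le> 2 * u y"
proof -
  define a where "a = min x y"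
  define b where "b = max x y"
  have ab: "a \<le> b" "b - a \<le> 1 / (2 * K)" "x \<in> {a..b}" "y \<in> {a..b}"
    using xy by (auto simp: a_def b_def)
  obtain z where z: "z \<in> {a..b}" "\<And>t. t \<in> {a..b} \<Longrightarrow> u t \<le> u z"
    using continuous_attains_sup[of "{a..b}" u] continuous_on_subset[OF cont, of "{a..b}"] ab by auto
  have bound: "\<bar>u q - u p\<bar> \<le> u z / 2" if "a \<le> p" "p \<le> q" "q \<le> b" for p q
  proof -
    have i: "set_integrable lebesgue {p..q} v"
      using uv by (simp add: has_weak_deriv_def locally_integrable_def)
    have "u q - u p = integral {p..q} v"
      by (rule weak_deriv_ftc[OF uv \<open>p \<le> q\<close>]) (rule continuous_imp_right_lebesgue_point[OF cont])+
    also have "\<dots> = (LINT t|lebesgue. indicator {p..q} t *\<^sub>R v t)"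
      using set_lebesgue_integral_eq_integral(2)[OF i] by (simp add: set_lebesgue_integral_def)
    finally have "\<bar>u q - u p\<bar> = norm (LINT t|lebesgue. indicator {p..q} t *\<^sub>R v t)" by simp
    also have "\<dots> \<le> (LINT t|lebesgue. norm (indicator {p..q} t *\<^sub>R v t))"
      by (rule integral_norm_bound)
    also have "\<dots> \<le> (LINT t|lebesgue. indicator {p..q} t * (K * u z))"
    proof (rule integral_mono_AE)
      show "integrable lebesgue (\<lambda>t. norm (indicator {p..q} t *\<^sub>R v t))"
        using i by (simp add: set_integrable_def)
      show "integrable lebesgue (\<lambda>t. indicator {p..q} t * (K * u z))"
        by (intro integrable_mult_left integrable_real_indicator) (auto simp: emeasure_lborel_Icc_eq)
      show "AE t in lebesgue. norm (indicator {p..q} t *\<^sub>R v t) \<le> indicator {p..q} t * (K * u z)"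
        using K(2)
      proof eventually_elim
        case (elim t)
        then show ?case
          using z(2)[of t] that K(1) by (auto simp: indicator_def intro: order_trans)
      qed
    qed
    also have "\<dots> = (q - p) * (K * u z)"
      using that by simp
    also have "\<dots> \<le> 1 / (2 * K) * (K * u z)"
      using that ab K pos[of z] by (intro mult_right_mono) auto
    finally show ?thesis using K by simp
  qed
  have "\<bar>u z - u y\<bar> \<le> u z / 2"
  proof (cases "z \<le> y")
    case True
    with bound[of z y] z ab show ?thesis by (simp add: abs_minus_commute)
  next
    case False
    with bound[of y z] z ab show ?thesis by simp
  qed
  then show ?thesis using z(2)[OF ab(3)] by linarith
qed

text \<open>
  A large value at \<open>x\<close> forces large values on an interval of fixed length, which the square integral
  limits.
\<close>
lemma square_integrable_harnack_imp_bounded: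
  fixes u :: "real \<Rightarrow> real" and d :: real
  assumes cont: "continuous_on UNIV u" and pos: "\<And>x. u x > 0"
    and int: "integrable lebesgue (\<lambda>x. (u x)\<^sup>2)"
    and d: "d > 0" "\<And>x y. \<bar>x - y\<bar> \<le> d \<Longrightarrow> u x \<le> 2 * u y"
  shows "\<exists>B. \<forall>x. u x \<le> B"
proof (intro exI allI)
  fix x :: real
  have "d * (u x)\<^sup>2 = (LINT y|lebesgue. indicator {x..x + d} y * (u x)\<^sup>2)"
    using d by simp
  also have "\<dots> \<le> (LINT y|lebesgue. 4 * (u y)\<^sup>2)"
  proof (rule integral_mono)
    fix y
    show "indicator {x..x + d} y * (u x)\<^sup>2 \<le> 4 * (u y)\<^sup>2"
      using power_mono[of "u x" "2 * u y" 2] d(2)[of x y] pos[of x]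
      by (auto simp: indicator_def power_mult_distrib)
  qed (use int in \<open>auto intro!: integrable_mult_left integrable_real_indicator simp: emeasure_lborel_Icc_eq\<close>)
  finally have "(u x)\<^sup>2 \<le> 4 * (LINT y|lebesgue. (u y)\<^sup>2) / d"
    using d by (simp add: field_simps)
  moreover have "u x \<le> 1 + (u x)\<^sup>2"
    using zero_le_power2[of "u x - 1"] pos[of x] by (simp add: power2_eq_square algebra_simps)
  ultimately show "u x \<le> 1 + 4 * (LINT y|lebesgue. (u y)\<^sup>2) / d" by linarith
qed

text \<open>
  Reflection moves \<open>x\<close> from the kernel, which is merely integrable, into the bounded continuous
  factor; then dominated convergence applies.
\<close>
lemma conv_bounded_continuous:
  assumes w: "integrable lebesgue w" and g: "continuous_on UNIV g" "\<And>x. \<bar>g x\<bar> \<le> B"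
  shows "integrable lebesgue (\<lambda>z. w z * g (x - z))"
    and "conv w g x = (LINT z|lebesgue. w z * g (x - z))"
    and "continuous_on UNIV (conv w g)"
proof -
  have meas: "(\<lambda>z. w z * g (x - z)) \<in> borel_measurable lebesgue" for x
    by (intro borel_measurable_times[OF borel_measurable_integrable[OF w]] continuous_imp_lebesgue_measurable
        continuous_on_compose2[OF g(1)] continuous_intros) auto
  have bound: "norm (w z * g (x - z)) \<le> \<bar>w z\<bar> * B" for x z
    using g(2) by (simp add: abs_mult mult_left_mono)
  have iB: "integrable lebesgue (\<lambda>z. \<bar>w z\<bar> * B)" using w by simp
  show "integrable lebesgue (\<lambda>z. w z * g (x - z))"
    by (rule Bochner_Integration.integrable_bound[OF iB meas])
       (use bound order_trans[OF _ abs_ge_self] in \<open>auto intro!: AE_I2\<close>)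
  have eq: "conv w g x = (LINT z|lebesgue. w z * g (x - z))" for x
    unfolding conv_def by (subst lebesgue_integral_real_affine[of "-1" _ x]) simp_all
  then show "conv w g x = (LINT z|lebesgue. w z * g (x - z))" .
  have "(\<lambda>n. conv w g (xs n)) \<longlonglongrightarrow> conv w g x" if "xs \<longlonglongrightarrow> x" for xs x
    unfolding eq
  proof (rule integral_dominated_convergence[OF meas meas iB])
    show "AE z in lebesgue. (\<lambda>n. w z * g (xs n - z)) \<longlonglongrightarrow> w z * g (x - z)"
      using that g(1) by (intro AE_I2 tendsto_intros continuous_on_tendsto_compose[OF g(1)]) auto
  qed (use bound in auto)
  then show "continuous_on UNIV (conv w g)"
    by (auto simp: continuous_on_sequentially o_def)
qed

lemma P_op_conv: "P_op r q w v x = r x * conv w (\<lambda>y. q y * v y) x"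
  unfolding P_op_def p_kernel_def conv_def
  by (subst Bochner_Integration.integral_mult_right_zero[symmetric]) (simp add: mult_ac)

lemma P_adj_eq_P_op: "P_adj r q w = P_op q r (\<lambda>z. w (- z))"
  by (intro ext) (simp add: P_adj_def P_op_def p_kernel_def mult_ac)

text \<open>
  The adjoint is an operator of the same kind: the drift changes sign, \<open>r\<close> and \<open>q\<close> are exchanged and
  the convolution kernel is reflected. Hence what holds for \<open>ux\<close> holds for \<open>\<psi>\<close>.
\<close>
lemma L_adj_eq_L_op: "L_adj c d f r q w = L_op (- c) d f q r (\<lambda>z. w (- z))"
  by (intro ext) (simp add: L_adj_def L_op_def P_adj_eq_P_op A_adj_def A_op_def)

lemma bounded_pos_bounds:
  fixes r :: "real \<Rightarrow> real"
  assumes "bounded (range r)" "(INF x. r x) > 0"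
  obtains l B where "0 < l" "\<And>x. l \<le> r x" "\<And>x. r x \<le> B" "0 < B"
proof -
  obtain B where B: "\<And>x. \<bar>r x\<bar> \<le> B" using assms(1) by (auto simp: bounded_iff)
  have "bdd_below (range r)" using assms(1) by (rule bounded_imp_bdd_below)
  then have l: "(INF x. r x) \<le> r x" for x by (intro cINF_lower) auto
  have "r x \<le> B" "0 < B" for x using B[of x] l[of x] assms(2) by linarith+
  then show ?thesis using that[of "INF x. r x" B] l assms(2) by blast
qed

text \<open>
  The null vector equation expresses \<open>P u\<close> by \<open>u\<close> and its derivatives, which the bounds on the
  logarithmic derivatives dominate by multiples of \<open>u\<close>; this holds almost everywhere and extends to
  all points by continuity. For the lower bound only the part of the convolution near the diagonal is
  kept, where \<open>u\<close> is comparable to \<open>u x\<close> and the kernel has positive mass.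
\<close>
lemma P_op_null_vector_comparable:
  assumes d_nonneg: "d \<ge> 0" and f: "bounded (range f)"
    and r: "continuous_on UNIV r" "bounded (range r)" "(INF x. r x) > 0"
    and q: "continuous_on UNIV q" "bounded (range q)" "(INF x. q x) > 0"
    and w: "\<And>x. w x \<ge> 0" "integrable lebesgue w" "\<forall>\<^sub>F x in nhds 0. w x > 0"
    and u: "nonzero_null_vector (L_op c d f r q w) u" "continuous_on UNIV u" "\<And>x. u x > 0"
    and log_derivs: "Linf_norm (\<lambda>x. weak_deriv (weak_deriv u) x / u x) < \<infinity>"
      "Linf_norm (\<lambda>x. weak_deriv u x / u x) < \<infinity>"
  shows "continuous_on UNIV (P_op r q w u)"
    and "\<exists>\<delta>1>0. \<forall>x. \<delta>1 * u x \<le> P_op r q w u x"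
    and "\<exists>\<delta>2>0. \<forall>x. P_op r q w u x \<le> \<delta>2 * u x"
proof -
  obtain r0 r1 where r01: "0 < r0" "\<And>x. r0 \<le> r x" "\<And>x. r x \<le> r1" "0 < r1"
    using bounded_pos_bounds[OF r(2,3)] by blast
  obtain q0 q1 where q01: "0 < q0" "\<And>x. q0 \<le> q x" "\<And>x. q x \<le> q1" "0 < q1"
    using bounded_pos_bounds[OF q(2,3)] by blast
  obtain F where F: "\<And>x. \<bar>f x\<bar> \<le> F" using f by (auto simp: bounded_iff)
  have sob: "sobolev 2 u" and eq: "AE x in lebesgue. L_op c d f r q w u x = 0"
    using u(1) by (simp_all add: nonzero_null_vector_def)
  obtain K1 where K1: "K1 > 0" "AE x in lebesgue. \<bar>weak_deriv u x / u x\<bar> \<le> K1"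
    using Linf_norm_bound[OF log_derivs(2)] by blast
  obtain K2 where K2: "K2 > 0" "AE x in lebesgue. \<bar>weak_deriv (weak_deriv u) x / u x\<bar> \<le> K2"
    using Linf_norm_bound[OF log_derivs(1)] by blast
  define \<delta> where "\<delta> = 1 / (2 * K1)"
  have \<delta>: "\<delta> > 0" using K1 by (simp add: \<delta>_def)
  have abs_div: "\<bar>a\<bar> \<le> K * u x" if "\<bar>a / u x\<bar> \<le> K" for a K x
    using that u(3)[of x] by (simp add: abs_div_pos[symmetric] divide_le_eq)
  have harnack: "u x \<le> 2 * u y" if "\<bar>x - y\<bar> \<le> \<delta>" for x y
    by (rule weak_deriv_local_harnack[OF weighted_sobolev_weak_deriv[OF sob] u(2,3) K1(1)])
       (use that K1(2) abs_div in \<open>auto simp: \<delta>_def elim: eventually_mono\<close>)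
  have "weighted_L2 (\<lambda>_. 1) ((weak_deriv ^^ 0) u)"
    using sob unfolding weighted_sobolev_def by blast
  then have "integrable lebesgue (\<lambda>x. (u x)\<^sup>2)"
    by (simp add: weighted_L2_def weighted_measure_def density_1)
  from square_integrable_harnack_imp_bounded[OF u(2,3) this \<delta> harnack]
  obtain B where B: "\<And>x. u x \<le> B" by blast
  define g where "g = (\<lambda>y. q y * u y)"
  have g_pos: "0 < g x" for x
    using q01(1) q01(2)[of x] u(3)[of x] unfolding g_def by (intro mult_pos_pos) auto
  have g: "continuous_on UNIV g" unfolding g_def by (intro continuous_intros q u)
  have g_bound: "\<bar>g x\<bar> \<le> q1 * B" for x
  proof -
    have "g x \<le> q1 * B" unfolding g_def
      using q01 B u(3)[of x] by (intro mult_mono) (auto intro: less_imp_le)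
    then show ?thesis using g_pos[of x] by simp
  qed
  note conv_g = conv_bounded_continuous[OF w(2) g g_bound]
  have P: "P_op r q w u x = r x * conv w g x" for x
    by (simp add: P_op_conv g_def)
  show cont: "continuous_on UNIV (P_op r q w u)"
    unfolding P[abs_def] by (intro continuous_intros r conv_g)

  define C where "C = F + \<bar>c\<bar> * K1 + d * K2"
  have "AE x in lebesgue. P_op r q w u x \<le> C * u x"
    using eq K1(2) K2(2)
  proof eventually_elim
    case (elim x)
    have "P_op r q w u x = f x * u x + - (c * weak_deriv u x) + - (d * weak_deriv (weak_deriv u) x)"
      using elim(1) by (simp add: L_op_def A_op_def)
    also have "f x * u x \<le> F * u x"
      using F[of x] u(3)[of x] by (intro mult_right_mono) auto
    also have "- (c * weak_deriv u x) \<le> \<bar>c\<bar> * (K1 * u x)"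
      using abs_ge_minus_self[of "c * weak_deriv u x"] mult_left_mono[OF abs_div[OF elim(2)] abs_ge_zero[of c]]
      unfolding abs_mult by linarith
    also have "- (d * weak_deriv (weak_deriv u) x) \<le> d * (K2 * u x)"
      using abs_ge_minus_self[of "d * weak_deriv (weak_deriv u) x"] mult_left_mono[OF abs_div[OF elim(3)] d_nonneg] d_nonneg
      unfolding abs_mult by simp
    finally show ?case by (simp add: C_def algebra_simps)
  qed
  then have "P_op r q w u x \<le> C * u x" for x
    by (intro AE_le_imp_le_continuous[OF cont]) (auto intro!: continuous_intros u)
  moreover have "C * u x \<le> max 1 C * u x" for x
    using u(3)[of x] by (intro mult_right_mono) auto
  ultimately show "\<exists>\<delta>2>0. \<forall>x. P_op r q w u x \<le> \<delta>2 * u x"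
    by (intro exI[of _ "max 1 C"]) (auto intro: order_trans)

  \<comment> \<open>The mass of the kernel on the scale of the local Harnack inequality.\<close>
  define m where "m = (LINT z|lebesgue. indicator {-\<delta>..\<delta>} z * w z)"
  have iw: "integrable lebesgue (\<lambda>z. indicator {-\<delta>..\<delta>} z * w z)"
    using integrable_real_mult_indicator[OF _ w(2), of "{-\<delta>..\<delta>}"] by (simp add: mult.commute)
  have "m > 0"
  proof (rule ccontr)
    obtain e where e: "e > 0" "\<And>z. \<bar>z\<bar> < e \<Longrightarrow> w z > 0"
      using w(3) by (auto simp: eventually_nhds_metric dist_real_def)
    assume "\<not> m > 0"
    moreover have "m \<ge> 0" unfolding m_def using w(1) by (intro integral_nonneg_AE) auto
    ultimately have "m = 0" by simp
    then have "AE z in lebesgue. indicator {-\<delta>..\<delta>} z * w z = 0"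
      unfolding m_def using w(1) by (subst (asm) integral_nonneg_eq_0_iff_AE[OF iw]) auto
    moreover have "z \<notin> {- min e \<delta><..<min e \<delta>}" if "indicator {-\<delta>..\<delta>} z * w z = 0" for z
    proof
      assume "z \<in> {- min e \<delta><..<min e \<delta>}"
      then have "- min e \<delta> < z" "z < min e \<delta>" by simp_all
      then have "\<bar>z\<bar> < e" "z \<in> {-\<delta>..\<delta>}" by (linarith, simp)
      then show False using that e(2)[of z] by simp
    qed
    ultimately have "AE z in lebesgue. z \<notin> {- min e \<delta><..<min e \<delta>}"
      by (rule eventually_mono)
    then have "negligible {- min e \<delta><..<min e \<delta>}"
      by (simp add: AE_iff_null_sets negligible_iff_null_sets)
    then show False
      using open_not_negligible[of "{- min e \<delta><..<min e \<delta>}"] e \<delta> by auto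
  qed
  have lower: "r0 * (q0 * m / 2) * u x \<le> P_op r q w u x" for x
  proof -
    have "q0 * m / 2 * u x = (LINT z|lebesgue. (indicator {-\<delta>..\<delta>} z * w z) * (q0 * u x / 2))"
      by (subst Bochner_Integration.integral_mult_left_zero) (simp add: m_def)
    also have "\<dots> \<le> (LINT z|lebesgue. w z * g (x - z))"
    proof (rule integral_mono)
      show "integrable lebesgue (\<lambda>z. (indicator {-\<delta>..\<delta>} z * w z) * (q0 * u x / 2))"
        by (intro integrable_mult_left iw)
      show "integrable lebesgue (\<lambda>z. w z * g (x - z))" by (rule conv_g)
      fix z
      have "q0 * u x / 2 \<le> g (x - z)" if "z \<in> {-\<delta>..\<delta>}"
      proof -
        have "q0 * (u x / 2) \<le> q (x - z) * u (x - z)"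
          using harnack[of x "x - z"] that q01 u(3)[of x] order_trans[OF less_imp_le[OF q01(1)] q01(2)]
          by (intro mult_mono) (auto simp: abs_le_iff)
        then show ?thesis by (simp add: g_def)
      qed
      then show "(indicator {-\<delta>..\<delta>} z * w z) * (q0 * u x / 2) \<le> w z * g (x - z)"
        using w(1)[of z] g_pos[of "x - z"] mult_left_mono[of "q0 * u x / 2" "g (x - z)" "w z"]
        by (cases "z \<in> {-\<delta>..\<delta>}") simp_all
    qed
    also have "\<dots> = conv w g x" by (simp add: conv_g)
    finally have "r0 * (q0 * m / 2 * u x) \<le> r x * conv w g x"
      using r01 q01(1) \<open>m > 0\<close> u(3)[of x] order_trans[OF less_imp_le[OF r01(1)] r01(2)]
      by (intro mult_mono) (auto intro: less_imp_le)
    then show ?thesis by (simp add: P mult.assoc)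
  qed
  show "\<exists>\<delta>1>0. \<forall>x. \<delta>1 * u x \<le> P_op r q w u x"
    using lower r01(1) q01(1) \<open>m > 0\<close> by (intro exI[of _ "r0 * (q0 * m / 2)"]) auto
qed

section \<open>A weighted Hardy inequality\<close>

lemma nn_integral_exp_decay_right:
  assumes "a > 0"
  shows "(\<integral>\<^sup>+x. ennreal (exp (- a * (x - s))) * indicator {s..} x \<partial>lborel) = ennreal (1 / a)"
proof -
  have "((\<lambda>x. - (exp (- a * (x - s)) / a)) \<longlongrightarrow> 0) at_top"
    using assms by real_asymp
  then have "(\<integral>\<^sup>+x. ennreal (exp (- a * (x - s))) * indicator {s..} x \<partial>lborel)
      = ennreal (0 - (- (exp (- a * (s - s)) / a)))"
    using assms by (intro nn_integral_FTC_atLeast) (auto intro!: derivative_eq_intros)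
  then show ?thesis by simp
qed

lemma nn_integral_exp_decay_left:
  assumes "a > 0"
  shows "(\<integral>\<^sup>+s. ennreal (exp (- a * (x - s))) * indicator {..x} s \<partial>lborel) = ennreal (1 / a)"
proof -
  have "(\<integral>\<^sup>+s. ennreal (exp (- a * (x - s))) * indicator {..x} s \<partial>lborel)
      = (\<integral>\<^sup>+s. ennreal (exp (- a * (s - (- x)))) * indicator {- x..} s \<partial>lborel)"
    by (subst nn_integral_real_affine[where c="-1" and t=0])
       (auto intro!: nn_integral_cong simp: indicator_def algebra_simps)
  then show ?thesis using nn_integral_exp_decay_right[OF assms, of "- x"] by simp
qed

text \<open>
  Cauchy--Schwarz after inserting the factors \<open>exp (a * (x - s) / 2)\<close> and \<open>exp (- a * (x - s) / 2)\<close>. The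
  negative exponential has a square integral bounded uniformly in \<open>x\<close>; the growing one is left for the
  decay of the measure to absorb.
\<close>
lemma square_nn_integral_exp_weight:
  fixes v :: "real \<Rightarrow> real"
  assumes [measurable]: "v \<in> borel_measurable borel" and "a > 0"
  shows "(\<integral>\<^sup>+s. indicator {0<..<x} s * ennreal \<bar>v s\<bar> \<partial>lborel)\<^sup>2
    \<le> ennreal (1 / a) * (\<integral>\<^sup>+s. indicator {0<..<x} s * ennreal ((v s)\<^sup>2 * exp (a * (x - s))) \<partial>lborel)"
proof -
  let ?f = "\<lambda>s. indicator {0<..<x} s * ennreal (\<bar>v s\<bar> * exp (a * (x - s) / 2))"
  let ?g = "\<lambda>s. indicator {0<..<x} s * ennreal (exp (- (a * (x - s) / 2)))"
  have eq: "(\<integral>\<^sup>+s. indicator {0<..<x} s * ennreal \<bar>v s\<bar> \<partial>lborel) = (\<integral>\<^sup>+s. ?f s * ?g s \<partial>lborel)"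
    by (intro nn_integral_cong)
       (auto simp: indicator_def ennreal_mult[symmetric] mult.assoc exp_add[symmetric])
  have cs: "(\<integral>\<^sup>+s. ?f s * ?g s \<partial>lborel)\<^sup>2 \<le> (\<integral>\<^sup>+s. (?f s)\<^sup>2 \<partial>lborel) * (\<integral>\<^sup>+s. (?g s)\<^sup>2 \<partial>lborel)"
    by (rule Cauchy_Schwarz_nn_integral) measurable
  have "(\<integral>\<^sup>+s. (?g s)\<^sup>2 \<partial>lborel) \<le> (\<integral>\<^sup>+s. ennreal (exp (- a * (x - s))) * indicator {..x} s \<partial>lborel)"
    by (intro nn_integral_mono)
       (auto simp: indicator_def power2_eq_square ennreal_mult[symmetric] exp_add[symmetric])
  also have "\<dots> = ennreal (1 / a)" by (rule nn_integral_exp_decay_left[OF \<open>a > 0\<close>])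
  finally have g: "(\<integral>\<^sup>+s. (?g s)\<^sup>2 \<partial>lborel) \<le> ennreal (1 / a)" .
  have f: "(\<integral>\<^sup>+s. (?f s)\<^sup>2 \<partial>lborel)
      = (\<integral>\<^sup>+s. indicator {0<..<x} s * ennreal ((v s)\<^sup>2 * exp (a * (x - s))) \<partial>lborel)"
  proof (intro nn_integral_cong)
    fix s
    have "(\<bar>v s\<bar> * exp (a * (x - s) / 2))\<^sup>2 = (v s)\<^sup>2 * exp (a * (x - s))"
      by (simp add: power_mult_distrib exp_double[symmetric])
    then show "(?f s)\<^sup>2 = indicator {0<..<x} s * ennreal ((v s)\<^sup>2 * exp (a * (x - s)))"
      by (simp add: indicator_def ennreal_power)
  qed
  show ?thesis
    using order_trans[OF cs mult_left_mono[OF g]] unfolding eq f by (simp add: mult.commute)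
qed

text \<open>
  By the preceding lemma and Tonelli it suffices to bound the integral of \<open>exp (a * (x - s)) * m x\<close> over
  \<open>x > s\<close> by a multiple of \<open>m s\<close>, which the decay of \<open>m\<close> gives for any \<open>a < \<alpha>\<close>. The resulting constant
  is \<open>k / (a * (\<alpha> - a))\<close>.
\<close>
lemma hardy_exponential_decay:
  fixes v m :: "real \<Rightarrow> real"
  assumes v[measurable]: "v \<in> borel_measurable borel" and m[measurable]: "m \<in> borel_measurable borel"
    and m_nonneg: "\<And>x. 0 \<le> m x" and "\<alpha> > 0" and "k \<ge> 0"
    and decay: "\<And>x y. 0 \<le> x \<Longrightarrow> 0 \<le> y \<Longrightarrow> m (x + y) \<le> k * exp (- \<alpha> * y) * m x"
  shows "(\<integral>\<^sup>+x. indicator {0<..} x * (\<integral>\<^sup>+s. indicator {0<..<x} s * ennreal \<bar>v s\<bar> \<partial>lborel)\<^sup>2 * ennreal (m x) \<partial>lborel)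
     \<le> ennreal (4 * k / \<alpha>\<^sup>2) * (\<integral>\<^sup>+s. indicator {0<..} s * ennreal ((v s)\<^sup>2 * m s) \<partial>lborel)"
proof -
  \<comment> \<open>This choice minimises \<open>k / (a * (\<alpha> - a))\<close>.\<close>
  define a where "a = \<alpha> / 2"
  have a: "a > 0" using \<open>\<alpha> > 0\<close> by (simp add: a_def)
  let ?w = "\<lambda>x s. indicator {0<..<x} s * ennreal ((v s)\<^sup>2 * exp (a * (x - s)) * m x)"
  have "(\<integral>\<^sup>+x. indicator {0<..} x * (\<integral>\<^sup>+s. indicator {0<..<x} s * ennreal \<bar>v s\<bar> \<partial>lborel)\<^sup>2 * ennreal (m x) \<partial>lborel)
      \<le> (\<integral>\<^sup>+x. ennreal (1 / a) * (\<integral>\<^sup>+s. ?w x s \<partial>lborel) \<partial>lborel)"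
  proof (rule nn_integral_mono)
    fix x
    let ?I = "\<integral>\<^sup>+s. indicator {0<..<x} s * ennreal \<bar>v s\<bar> \<partial>lborel"
    have "indicator {0<..} x * ?I\<^sup>2 * ennreal (m x) \<le> ?I\<^sup>2 * ennreal (m x)"
      by (auto simp: indicator_def)
    also have "\<dots> \<le> ennreal (1 / a) * (\<integral>\<^sup>+s. indicator {0<..<x} s * ennreal ((v s)\<^sup>2 * exp (a * (x - s))) \<partial>lborel) * ennreal (m x)"
      by (intro mult_right_mono square_nn_integral_exp_weight v a) simp
    also have "\<dots> = ennreal (1 / a) * (\<integral>\<^sup>+s. indicator {0<..<x} s * ennreal ((v s)\<^sup>2 * exp (a * (x - s))) * ennreal (m x) \<partial>lborel)"
      by (subst nn_integral_multc) (auto simp: mult.assoc)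
    also have "\<dots> = ennreal (1 / a) * (\<integral>\<^sup>+s. ?w x s \<partial>lborel)"
      using m_nonneg by (simp add: mult.assoc ennreal_mult[symmetric])
    finally show "indicator {0<..} x * ?I\<^sup>2 * ennreal (m x) \<le> ennreal (1 / a) * (\<integral>\<^sup>+s. ?w x s \<partial>lborel)" .
  qed
  also have "\<dots> = ennreal (1 / a) * (\<integral>\<^sup>+x. (\<integral>\<^sup>+s. ?w x s \<partial>lborel) \<partial>lborel)"
    by (rule nn_integral_cmult) (simp add: indicator_def, measurable)
  also have "(\<integral>\<^sup>+x. (\<integral>\<^sup>+s. ?w x s \<partial>lborel) \<partial>lborel) = (\<integral>\<^sup>+s. (\<integral>\<^sup>+x. ?w x s \<partial>lborel) \<partial>lborel)"
    by (rule lborel_pair.Fubini'[symmetric]) (simp add: indicator_def, measurable)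
  also have "\<dots> \<le> (\<integral>\<^sup>+s. ennreal (k / a) * (indicator {0<..} s * ennreal ((v s)\<^sup>2 * m s)) \<partial>lborel)"
  proof (rule nn_integral_mono)
    fix s
    let ?c = "indicator {0<..} s * ennreal ((v s)\<^sup>2 * k * m s)"
    have "(\<integral>\<^sup>+x. ?w x s \<partial>lborel) \<le> (\<integral>\<^sup>+x. ?c * (ennreal (exp (- a * (x - s))) * indicator {s..} x) \<partial>lborel)"
    proof (rule nn_integral_mono)
      fix x
      show "?w x s \<le> ?c * (ennreal (exp (- a * (x - s))) * indicator {s..} x)"
      proof (cases "0 < s \<and> s < x")
        case True
        have "m x \<le> k * exp (- \<alpha> * (x - s)) * m s"
          using decay[of s "x - s"] True by simp
        then have "exp (a * (x - s)) * m x \<le> exp (a * (x - s)) * (k * exp (- \<alpha> * (x - s)) * m s)"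
          by (intro mult_left_mono) auto
        also have "\<dots> = k * m s * (exp (a * (x - s)) * exp (- \<alpha> * (x - s)))" by simp
        also have "exp (a * (x - s)) * exp (- \<alpha> * (x - s)) = exp (- a * (x - s))"
          by (simp add: exp_add[symmetric] a_def field_simps)
        finally have "(v s)\<^sup>2 * (exp (a * (x - s)) * m x) \<le> (v s)\<^sup>2 * (k * m s * exp (- a * (x - s)))"
          by (rule mult_left_mono) simp
        then show ?thesis
          using True m_nonneg[of s] \<open>k \<ge> 0\<close> by (simp add: ennreal_mult[symmetric] mult_ac ennreal_leI)
      qed (auto simp: indicator_def)
    qed
    also have "\<dots> = ?c * ennreal (1 / a)"
      by (subst nn_integral_cmult) (auto simp: nn_integral_exp_decay_right[OF a, simplified])
    also have "\<dots> = ennreal (k / a) * (indicator {0<..} s * ennreal ((v s)\<^sup>2 * m s))"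
      using a \<open>k \<ge> 0\<close> m_nonneg by (simp add: indicator_def ennreal_mult[symmetric] mult_ac)
    finally show "(\<integral>\<^sup>+x. ?w x s \<partial>lborel) \<le> ennreal (k / a) * (indicator {0<..} s * ennreal ((v s)\<^sup>2 * m s))" .
  qed
  also have "\<dots> = ennreal (k / a) * (\<integral>\<^sup>+s. indicator {0<..} s * ennreal ((v s)\<^sup>2 * m s) \<partial>lborel)"
    by (rule nn_integral_cmult) measurable
  finally have "(\<integral>\<^sup>+x. indicator {0<..} x * (\<integral>\<^sup>+s. indicator {0<..<x} s * ennreal \<bar>v s\<bar> \<partial>lborel)\<^sup>2 * ennreal (m x) \<partial>lborel)
     \<le> ennreal (1 / a) * (ennreal (k / a) * (\<integral>\<^sup>+s. indicator {0<..} s * ennreal ((v s)\<^sup>2 * m s) \<partial>lborel))"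
    by (simp add: mult_left_mono)
  also have "\<dots> = ennreal (4 * k / \<alpha>\<^sup>2) * (\<integral>\<^sup>+s. indicator {0<..} s * ennreal ((v s)\<^sup>2 * m s) \<partial>lborel)"
    using a \<open>k \<ge> 0\<close> by (simp add: mult.assoc[symmetric] ennreal_mult[symmetric] a_def power2_eq_square)
  finally show ?thesis .
qed

lemma hardy_exponential_decay_left:
  fixes v m :: "real \<Rightarrow> real"
  assumes v[measurable]: "v \<in> borel_measurable borel" and m[measurable]: "m \<in> borel_measurable borel"
    and m_nonneg: "\<And>x. 0 \<le> m x" and "\<alpha> > 0" and "k \<ge> 0"
    and decay: "\<And>x y. 0 \<le> x \<Longrightarrow> 0 \<le> y \<Longrightarrow> m (- x - y) \<le> k * exp (- \<alpha> * y) * m (- x)"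
  shows "(\<integral>\<^sup>+x. indicator {..<0} x * (\<integral>\<^sup>+s. indicator {x<..<0} s * ennreal \<bar>v s\<bar> \<partial>lborel)\<^sup>2 * ennreal (m x) \<partial>lborel)
     \<le> ennreal (4 * k / \<alpha>\<^sup>2) * (\<integral>\<^sup>+s. indicator {..<0} s * ennreal ((v s)\<^sup>2 * m s) \<partial>lborel)"
proof -
  have reflect: "(\<integral>\<^sup>+x. f x \<partial>lborel) = (\<integral>\<^sup>+x. f (- x) \<partial>lborel)" if "f \<in> borel_measurable borel" for f :: "real \<Rightarrow> ennreal"
    using nn_integral_real_affine[OF that, of "-1" 0] by simp
  have inner: "(\<integral>\<^sup>+s. indicator {x<..<0} s * ennreal \<bar>v s\<bar> \<partial>lborel)
      = (\<integral>\<^sup>+s. indicator {0<..<- x} s * ennreal \<bar>v (- s)\<bar> \<partial>lborel)" for x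
    by (subst reflect) (auto intro!: nn_integral_cong simp: indicator_def)
  have "(\<integral>\<^sup>+x. indicator {..<0} x * (\<integral>\<^sup>+s. indicator {x<..<0} s * ennreal \<bar>v s\<bar> \<partial>lborel)\<^sup>2 * ennreal (m x) \<partial>lborel)
      = (\<integral>\<^sup>+x. indicator {0<..} x * (\<integral>\<^sup>+s. indicator {0<..<x} s * ennreal \<bar>v (- s)\<bar> \<partial>lborel)\<^sup>2 * ennreal (m (- x)) \<partial>lborel)"
    unfolding inner
    by (subst reflect) (simp add: indicator_def, measurable, auto intro!: nn_integral_cong simp: indicator_def)
  also have "\<dots> \<le> ennreal (4 * k / \<alpha>\<^sup>2) * (\<integral>\<^sup>+s. indicator {0<..} s * ennreal ((v (- s))\<^sup>2 * m (- s)) \<partial>lborel)"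
    by (rule hardy_exponential_decay[OF _ _ m_nonneg \<open>\<alpha> > 0\<close> \<open>k \<ge> 0\<close>])
       (measurable, use decay in \<open>auto simp: algebra_simps\<close>)
  also have "(\<integral>\<^sup>+s. indicator {0<..} s * ennreal ((v (- s))\<^sup>2 * m (- s)) \<partial>lborel)
      = (\<integral>\<^sup>+s. indicator {..<0} s * ennreal ((v s)\<^sup>2 * m s) \<partial>lborel)"
    by (subst (2) reflect) (auto intro!: nn_integral_cong simp: indicator_def)
  finally show ?thesis .
qed

section \<open>The Poincare inequality for exponentially decaying weights\<close>

text \<open>
  The variance is the smallest second moment about a constant, because the second moment about \<open>C\<close>
  exceeds it by the square of the distance from the mean to \<open>C\<close>.
\<close>
lemma Var_le_second_moment:
  assumes prob: "prob_space (weighted_measure m)" and h: "weighted_L2 m h"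
  shows "integrable (weighted_measure m) (\<lambda>x. (h x - C)\<^sup>2)"
    and "Var m h \<le> (LINT x|weighted_measure m. (h x - C)\<^sup>2)"
proof -
  interpret prob_space "weighted_measure m" by (rule prob)
  have meas: "h \<in> borel_measurable (weighted_measure m)"
    using h by (simp add: weighted_L2_def weighted_measure_def)
  have h2: "integrable (weighted_measure m) (\<lambda>x. (h x)\<^sup>2)"
    using h by (simp add: weighted_L2_def)
  then have h1: "integrable (weighted_measure m) h"
    by (rule square_integrable_imp_integrable[OF meas])
  have eq: "(h x - C)\<^sup>2 = (h x)\<^sup>2 - 2 * C * h x + C\<^sup>2" for x
    by (simp add: power2_eq_square algebra_simps)
  show "integrable (weighted_measure m) (\<lambda>x. (h x - C)\<^sup>2)"
    unfolding eq using h1 h2 by simp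
  have "(LINT x|weighted_measure m. (h x - C)\<^sup>2)
     = (LINT x|weighted_measure m. (h x)\<^sup>2) - 2 * C * (LINT x|weighted_measure m. h x) + C\<^sup>2"
    unfolding eq using h1 h2 by (simp add: prob_space)
  also have "\<dots> = Var m h + ((LINT x|weighted_measure m. h x) - C)\<^sup>2"
    by (simp add: Var_def power2_eq_square algebra_simps)
  finally show "Var m h \<le> (LINT x|weighted_measure m. (h x - C)\<^sup>2)" by simp
qed

lemma abs_integral_le_nn_integral:
  fixes v v' :: "real \<Rightarrow> real"
  assumes "set_integrable lebesgue {a..b} v" "AE x in lborel. v x = v' x"
  shows "ennreal \<bar>integral {a..b} v\<bar> \<le> (\<integral>\<^sup>+s. indicator {a<..<b} s * ennreal \<bar>v' s\<bar> \<partial>lborel)"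
proof -
  have "ennreal \<bar>integral {a..b} v\<bar> = ennreal (norm (LINT s|lebesgue. indicator {a..b} s *\<^sub>R v s))"
    using set_lebesgue_integral_eq_integral(2)[OF assms(1)] by (simp add: set_lebesgue_integral_def)
  also have "\<dots> \<le> (\<integral>\<^sup>+s. ennreal (norm (indicator {a..b} s *\<^sub>R v s)) \<partial>lebesgue)"
    using assms(1) unfolding set_integrable_def by (rule integral_norm_bound_ennreal)
  also have "\<dots> = (\<integral>\<^sup>+s. ennreal (norm (indicator {a..b} s *\<^sub>R v s)) \<partial>lborel)"
    by (rule nn_integral_completion)
  also have "\<dots> = (\<integral>\<^sup>+s. indicator {a<..<b} s * ennreal \<bar>v' s\<bar> \<partial>lborel)"
  proof (rule nn_integral_cong_AE)
    show "AE s in lborel. ennreal (norm (indicator {a..b} s *\<^sub>R v s)) = indicator {a<..<b} s * ennreal \<bar>v' s\<bar>"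
      using assms(2) AE_lborel_singleton[of a] AE_lborel_singleton[of b]
    proof eventually_elim
      case (elim s)
      then have "s \<in> {a..b} \<longleftrightarrow> s \<in> {a<..<b}" by auto
      with elim(1) show ?case by (simp add: indicator_def)
    qed
  qed
  finally show ?thesis .
qed

text \<open>
  Up to a constant \<open>C\<close>, the function \<open>h\<close> is the primitive of its weak derivative starting at \<open>0\<close>. The
  variance is at most the second moment about \<open>C\<close>, and the Hardy inequalities on the two half-lines
  bound the latter.
\<close>
lemma poincare_inequality_exponential_decay:
  fixes m :: "real \<Rightarrow> real"
  assumes m[measurable]: "m \<in> borel_measurable borel" and m_nonneg: "\<And>x. 0 \<le> m x"
    and prob: "prob_space (weighted_measure m)"
    and decay_right: "\<alpha> > 0" "k \<ge> 0" "\<And>x y. 0 \<le> x \<Longrightarrow> 0 \<le> y \<Longrightarrow> m (x + y) \<le> k * exp (- \<alpha> * y) * m x"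
    and decay_left: "\<beta> > 0" "l \<ge> 0" "\<And>x y. 0 \<le> x \<Longrightarrow> 0 \<le> y \<Longrightarrow> m (- x - y) \<le> l * exp (- \<beta> * y) * m (- x)"
    and h: "weighted_sobolev 1 m h"
  shows "Var m h \<le> max (4 * k / \<alpha>\<^sup>2) (4 * l / \<beta>\<^sup>2) * (LINT x|weighted_measure m. (weak_deriv h x)\<^sup>2)"
proof -
  define \<kappa> where "\<kappa> = max (4 * k / \<alpha>\<^sup>2) (4 * l / \<beta>\<^sup>2)"
  have \<kappa>: "\<kappa> \<ge> 0" using decay_right by (auto simp: \<kappa>_def le_max_iff_disj)
  define v where "v = weak_deriv h"
  have m_leb[measurable]: "m \<in> borel_measurable lebesgue"
    by (rule measurable_completion) simp
  have i: "weighted_L2 m ((weak_deriv ^^ 0) h)" "weighted_L2 m ((weak_deriv ^^ 1) h)"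
    using h unfolding weighted_sobolev_def by auto
  have hv: "has_weak_deriv h v"
    unfolding v_def by (rule weighted_sobolev_weak_deriv[OF h]) simp
  have L2: "weighted_L2 m h" "weighted_L2 m v" using i by (simp_all add: v_def)
  have h_meas[measurable]: "h \<in> borel_measurable lebesgue" and v_meas: "v \<in> borel_measurable lebesgue"
    using L2 by (simp_all add: weighted_L2_def)
  \<comment> \<open>Tonelli is applied on the Borel sigma-algebra, so \<open>v\<close> is replaced by a Borel representative.\<close>
  obtain v' where v'[measurable]: "v' \<in> borel_measurable borel" and vv': "AE x in lborel. v x = v' x"
    using completion_ex_borel_measurable_real[OF v_meas] by auto
  obtain C where C: "AE x in lebesgue. h x = C + (integral {0..x} v - integral {x..0} v)"
    using weak_deriv_primitive[OF hv] .
  have loc: "set_integrable lebesgue {a..b} v" for a b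
    using hv by (simp add: has_weak_deriv_def locally_integrable_def)
  let ?R = "\<lambda>x. \<integral>\<^sup>+s. indicator {0<..<x} s * ennreal \<bar>v' s\<bar> \<partial>lborel"
  let ?L = "\<lambda>x. \<integral>\<^sup>+s. indicator {x<..<0} s * ennreal \<bar>v' s\<bar> \<partial>lborel"
  have pointwise: "AE x in lebesgue. ennreal ((h x - C)\<^sup>2) \<le> indicator {0<..} x * (?R x)\<^sup>2 + indicator {..<0} x * (?L x)\<^sup>2"
    using C
  proof eventually_elim
    case (elim x)
    have sq: "ennreal (t\<^sup>2) = (ennreal \<bar>t\<bar>)\<^sup>2" for t by (simp add: ennreal_power)
    consider "x > 0" | "x = 0" | "x < 0" by linarith
    then show ?case
    proof cases
      case 1
      then show ?thesis
        using elim abs_integral_le_nn_integral[OF loc vv', of 0 x] by (simp add: sq power_mono)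
    next
      case 2
      then show ?thesis using elim by simp
    next
      case 3
      then show ?thesis
        using elim abs_integral_le_nn_integral[OF loc vv', of x 0] by (simp add: sq power_mono)
    qed
  qed
  have dens: "(\<integral>\<^sup>+x. ennreal (g x) \<partial>weighted_measure m) = (\<integral>\<^sup>+x. ennreal (g x) * ennreal (m x) \<partial>lebesgue)"
    if "g \<in> borel_measurable lebesgue" for g
    using that unfolding weighted_measure_def by (subst nn_integral_density) (auto simp: mult.commute)
  have "ennreal (LINT x|weighted_measure m. (h x - C)\<^sup>2) = (\<integral>\<^sup>+x. ennreal ((h x - C)\<^sup>2) \<partial>weighted_measure m)"
    by (intro nn_integral_eq_integral[symmetric] Var_le_second_moment[OF prob L2(1)]) simp
  also have "\<dots> = (\<integral>\<^sup>+x. ennreal ((h x - C)\<^sup>2) * ennreal (m x) \<partial>lebesgue)"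
    by (intro dens) simp
  also have "\<dots> \<le> (\<integral>\<^sup>+x. (indicator {0<..} x * (?R x)\<^sup>2 + indicator {..<0} x * (?L x)\<^sup>2) * ennreal (m x) \<partial>lebesgue)"
    using pointwise by (intro nn_integral_mono_AE) (auto elim!: eventually_mono intro!: mult_right_mono)
  also have "\<dots> = (\<integral>\<^sup>+x. (indicator {0<..} x * (?R x)\<^sup>2 + indicator {..<0} x * (?L x)\<^sup>2) * ennreal (m x) \<partial>lborel)"
    by (rule nn_integral_completion)
  also have "\<dots> = (\<integral>\<^sup>+x. indicator {0<..} x * (?R x)\<^sup>2 * ennreal (m x) \<partial>lborel)
      + (\<integral>\<^sup>+x. indicator {..<0} x * (?L x)\<^sup>2 * ennreal (m x) \<partial>lborel)"
    unfolding distrib_right by (rule nn_integral_add) (simp_all add: indicator_def, measurable)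
  also have "\<dots> \<le> ennreal (4 * k / \<alpha>\<^sup>2) * (\<integral>\<^sup>+s. indicator {0<..} s * ennreal ((v' s)\<^sup>2 * m s) \<partial>lborel)
      + ennreal (4 * l / \<beta>\<^sup>2) * (\<integral>\<^sup>+s. indicator {..<0} s * ennreal ((v' s)\<^sup>2 * m s) \<partial>lborel)"
    by (intro add_mono hardy_exponential_decay hardy_exponential_decay_left v' m m_nonneg decay_right decay_left)
  also have "\<dots> \<le> ennreal \<kappa> * (\<integral>\<^sup>+s. indicator {0<..} s * ennreal ((v' s)\<^sup>2 * m s) \<partial>lborel)
      + ennreal \<kappa> * (\<integral>\<^sup>+s. indicator {..<0} s * ennreal ((v' s)\<^sup>2 * m s) \<partial>lborel)"
    by (intro add_mono mult_right_mono ennreal_leI) (auto simp: \<kappa>_def)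
  also have "\<dots> = ennreal \<kappa> * (\<integral>\<^sup>+s. indicator {0<..} s * ennreal ((v' s)\<^sup>2 * m s)
        + indicator {..<0} s * ennreal ((v' s)\<^sup>2 * m s) \<partial>lborel)"
    by (subst nn_integral_add) (simp_all add: distrib_left)
  also have "\<dots> \<le> ennreal \<kappa> * (\<integral>\<^sup>+s. ennreal ((v s)\<^sup>2) * ennreal (m s) \<partial>lborel)"
  proof (intro mult_left_mono nn_integral_mono_AE)
    show "AE s in lborel. indicator {0<..} s * ennreal ((v' s)\<^sup>2 * m s) + indicator {..<0} s * ennreal ((v' s)\<^sup>2 * m s)
        \<le> ennreal ((v s)\<^sup>2) * ennreal (m s)"
      using vv'
    proof eventually_elim
      case (elim s)
      then show ?case using m_nonneg[of s] by (auto simp: indicator_def ennreal_mult)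
    qed
  qed simp
  also have "(\<integral>\<^sup>+s. ennreal ((v s)\<^sup>2) * ennreal (m s) \<partial>lborel) = (\<integral>\<^sup>+s. ennreal ((v s)\<^sup>2) \<partial>weighted_measure m)"
    using v_meas by (subst dens) (auto simp: nn_integral_completion)
  also have "\<dots> = ennreal (LINT x|weighted_measure m. (v x)\<^sup>2)"
    using L2(2) by (intro nn_integral_eq_integral) (auto simp: weighted_L2_def)
  also have "ennreal \<kappa> * \<dots> = ennreal (\<kappa> * (LINT x|weighted_measure m. (v x)\<^sup>2))"
    using \<kappa> by (simp add: ennreal_mult)
  finally have "(LINT x|weighted_measure m. (h x - C)\<^sup>2) \<le> \<kappa> * (LINT x|weighted_measure m. (v x)\<^sup>2)"
    using \<kappa> by (subst (asm) ennreal_le_iff) auto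
  with Var_le_second_moment(2)[OF prob L2(1), of C] show ?thesis
    by (simp add: \<kappa>_def v_def)
qed

section \<open>Comparability and the Poincare inequality for the travelling wave weight\<close>

theorem theorem6:
  fixes c d :: real and f r q w ux \<psi> :: "real \<Rightarrow> real"
  assumes d_nonneg: "d \<ge> 0"
    and f: "continuous_on UNIV f" "bounded (range f)"
    and r: "continuous_on UNIV r" "bounded (range r)" "(INF x. r x) > 0"
    and q: "continuous_on UNIV q" "bounded (range q)" "(INF x. q x) > 0"
    and w_nonneg: "\<And>x. w x \<ge> 0"
    and w_diff: "AE x in lebesgue. w differentiable (at x)"
    and w_int: "integrable lebesgue w" "(LINT x|lebesgue. w x) = 1"
    and wx_int: "integrable lebesgue (deriv w)"
    and ux: "unique_null_vector (L_op c d f r q w) ux" "continuous_on UNIV ux" "\<And>x. ux x > 0"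
    and psi: "unique_null_vector (L_adj c d f r q w) \<psi>" "continuous_on UNIV \<psi>" "\<And>x. \<psi> x > 0"
    and normalized: "(LINT x|lebesgue. ux x * \<psi> x) = 1"
    and w_pos: "\<forall>\<^sub>F x in nhds 0. w x > 0"
    and w_rho: "\<exists>K. \<forall>x. conv_exists w (rho ux \<psi>) x \<and> conv w (rho ux \<psi>) x \<le> K * rho ux \<psi> x"
    and conv_deriv: "\<And>v. weighted_L2 (rho ux \<psi>) v \<Longrightarrow>
          (AE x in lebesgue. conv_exists w v x \<and> conv_exists (deriv w) v x) \<and>
          has_weak_deriv (conv w v) (conv (deriv w) v)"
    and M_finite: "M_const r q w ux < \<infinity>"
    and mu_decay: "\<exists>\<alpha> \<beta> k l. \<alpha> > 0 \<and> \<beta> > 0 \<and> k > 0 \<and> l > 0 \<and>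
          (\<forall>x\<ge>0. \<forall>y\<ge>0.
             mu r q w ux \<psi> (x + y) \<le> k * exp (- \<alpha> * y) * mu r q w ux \<psi> x \<and>
             mu r q w ux \<psi> (- x - y) \<le> l * exp (- \<beta> * y) * mu r q w ux \<psi> (- x))"
    and log_derivs: "Linf_norm (\<lambda>x. weak_deriv (weak_deriv ux) x / ux x)
          + Linf_norm (\<lambda>x. weak_deriv ux x / ux x)
          + Linf_norm (\<lambda>x. weak_deriv (weak_deriv \<psi>) x / \<psi> x)
          + Linf_norm (\<lambda>x. weak_deriv \<psi> x / \<psi> x) < \<infinity>"
  shows "(\<exists>\<delta>1 \<delta>2 \<delta>1' \<delta>2'. \<delta>1 > 0 \<and> \<delta>2 > 0 \<and> \<delta>1' > 0 \<and> \<delta>2' > 0 \<and>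
            (\<forall>x. \<delta>1 * ux x \<le> P_op r q w ux x \<and> P_op r q w ux x \<le> \<delta>2 * ux x) \<and>
            (\<forall>x. \<delta>1' * \<psi> x \<le> P_adj r q w \<psi> x \<and> P_adj r q w \<psi> x \<le> \<delta>2' * \<psi> x))
       \<and> (\<exists>\<kappa>0>0. \<forall>h. weighted_sobolev 1 (mu r q w ux \<psi>) h \<longrightarrow>
            Var (mu r q w ux \<psi>) h
              \<le> \<kappa>0 * (LINT x|weighted_measure (mu r q w ux \<psi>). (weak_deriv h x)\<^sup>2))"
proof -
  have fin: "Linf_norm (\<lambda>x. weak_deriv (weak_deriv ux) x / ux x) < \<infinity>"
    "Linf_norm (\<lambda>x. weak_deriv ux x / ux x) < \<infinity>"
    "Linf_norm (\<lambda>x. weak_deriv (weak_deriv \<psi>) x / \<psi> x) < \<infinity>"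
    "Linf_norm (\<lambda>x. weak_deriv \<psi> x / \<psi> x) < \<infinity>"
    using log_derivs by (simp_all add: ennreal_add_less_top)
  let ?P = "P_op r q w ux" and ?w = "\<lambda>z. w (- z)"
  have ux_null: "nonzero_null_vector (L_op c d f r q w) ux"
    using ux(1) by (simp add: unique_null_vector_def)
  note P = P_op_null_vector_comparable[OF d_nonneg f(2) r q w_nonneg w_int(1) w_pos ux_null ux(2,3) fin(1,2)]
  obtain \<delta>1 where \<delta>1: "\<delta>1 > 0" "\<And>x. \<delta>1 * ux x \<le> ?P x" using P(2) by blast
  obtain \<delta>2 where \<delta>2: "\<delta>2 > 0" "\<And>x. ?P x \<le> \<delta>2 * ux x" using P(3) by blast

  have psi_null: "nonzero_null_vector (L_op (- c) d f q r ?w) \<psi>"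
    using psi(1) by (simp add: unique_null_vector_def L_adj_eq_L_op)
  have w'_int: "integrable lebesgue ?w"
    using lebesgue_integrable_real_affine[OF w_int(1), of "-1" 0] by simp
  have w'_pos: "\<forall>\<^sub>F x in nhds 0. ?w x > 0"
  proof -
    obtain e where "e > 0" "\<And>x. \<bar>x\<bar> < e \<Longrightarrow> w x > 0"
      using w_pos by (auto simp: eventually_nhds_metric dist_real_def)
    then show ?thesis
      by (auto simp: eventually_nhds_metric dist_real_def intro!: exI[of _ e])
  qed
  note P' = P_op_null_vector_comparable[OF d_nonneg f(2) q r w_nonneg w'_int w'_pos psi_null psi(2,3) fin(3,4)]
  obtain \<delta>1' where \<delta>1': "\<delta>1' > 0" "\<And>x. \<delta>1' * \<psi> x \<le> P_adj r q w \<psi> x"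
    using P'(2) by (auto simp: P_adj_eq_P_op)
  obtain \<delta>2' where \<delta>2': "\<delta>2' > 0" "\<And>x. P_adj r q w \<psi> x \<le> \<delta>2' * \<psi> x"
    using P'(3) by (auto simp: P_adj_eq_P_op)

  have P_pos: "?P x > 0" for x
    using \<delta>1(1) \<delta>1(2)[of x] mult_pos_pos[OF \<delta>1(1) ux(3)[of x]] by linarith
  have ux_psi: "integrable lebesgue (\<lambda>x. ux x * \<psi> x)"
    using normalized not_integrable_integral_eq by fastforce
  have P_psi: "integrable lebesgue (\<lambda>x. ?P x * \<psi> x)"
  proof (rule Bochner_Integration.integrable_bound)
    show "integrable lebesgue (\<lambda>x. \<delta>2 * (ux x * \<psi> x))" using ux_psi by simp
    show "(\<lambda>x. ?P x * \<psi> x) \<in> borel_measurable lebesgue"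
      by (intro continuous_imp_lebesgue_measurable continuous_intros P(1) psi(2))
    have "norm (?P x * \<psi> x) \<le> norm (\<delta>2 * (ux x * \<psi> x))" for x
      using mult_right_mono[OF \<delta>2(2)[of x], of "\<psi> x"] psi(3)[of x] P_pos[of x] \<delta>2(1) ux(3)[of x]
      by (simp add: mult.assoc)
    then show "AE x in lebesgue. norm (?P x * \<psi> x) \<le> norm (\<delta>2 * (ux x * \<psi> x))" by simp
  qed
  define Z where "Z = Z_mu r q w ux \<psi>"
  \<comment> \<open>The normalisation of \<open>\<psi>\<close> and the lower bound on \<open>P ux\<close> make \<open>Z\<close> positive; the upper bound has
    made it finite.\<close>
  have "\<delta>1 = (LINT x|lebesgue. \<delta>1 * (ux x * \<psi> x))" using normalized by simp
  also have "\<dots> \<le> Z"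
    unfolding Z_def Z_mu_def
  proof (rule integral_mono)
    show "\<delta>1 * (ux x * \<psi> x) \<le> ?P x * \<psi> x" for x
      using mult_right_mono[OF \<delta>1(2)[of x], of "\<psi> x"] psi(3)[of x] by (simp add: mult.assoc)
  qed (use ux_psi P_psi in auto)
  finally have Z: "Z > 0" using \<delta>1(1) by linarith
  define m where "m = mu r q w ux \<psi>"
  have m: "m x = 1 / Z * (?P x * \<psi> x)" for x by (simp add: m_def mu_def Z_def)
  have m_nonneg: "0 \<le> m x" for x
    unfolding m using Z P_pos[of x] psi(3)[of x] by simp
  have m_cont: "continuous_on UNIV m"
    unfolding m[abs_def] by (intro continuous_intros P(1) psi(2))
  have "integrable lebesgue m" "(LINT x|lebesgue. m x) = 1"
  proof -
    have m_eq: "m = (\<lambda>x. 1 / Z * (?P x * \<psi> x))" using m by blast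
    show "integrable lebesgue m"
      unfolding m_eq using P_psi by (rule integrable_mult_right)
    have "(LINT x|lebesgue. m x) = 1 / Z * Z"
      unfolding m_eq by (subst Bochner_Integration.integral_mult_right_zero) (simp add: Z_def Z_mu_def)
    then show "(LINT x|lebesgue. m x) = 1" using Z by simp
  qed
  then have prob: "prob_space (weighted_measure m)"
    using m_nonneg continuous_imp_lebesgue_measurable[OF m_cont]
    by (intro prob_spaceI) (simp add: weighted_measure_def emeasure_density nn_integral_eq_integral)
  obtain \<alpha> \<beta> k l where decay: "\<alpha> > 0" "\<beta> > 0" "k > 0" "l > 0"
    and both: "\<forall>x\<ge>0. \<forall>y\<ge>0. m (x + y) \<le> k * exp (- \<alpha> * y) * m x
      \<and> m (- x - y) \<le> l * exp (- \<beta> * y) * m (- x)"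
    using mu_decay unfolding m_def[symmetric] by (elim exE conjE) (rule that)
  have right: "m (x + y) \<le> k * exp (- \<alpha> * y) * m x"
    and left: "m (- x - y) \<le> l * exp (- \<beta> * y) * m (- x)" if "0 \<le> x" "0 \<le> y" for x y
    using both that by simp_all
  define \<kappa> where "\<kappa> = max (4 * k / \<alpha>\<^sup>2) (4 * l / \<beta>\<^sup>2)"
  have \<kappa>: "\<kappa> > 0" using decay by (simp add: \<kappa>_def less_max_iff_disj)
  have poincare: "Var m h \<le> \<kappa> * (LINT x|weighted_measure m. (weak_deriv h x)\<^sup>2)"
    if "weighted_sobolev 1 m h" for h
    unfolding \<kappa>_def
    by (rule poincare_inequality_exponential_decay[OF borel_measurable_continuous_onI[OF m_cont] m_nonneg prob decay(1) less_imp_le[OF decay(3)]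
          right decay(2) less_imp_le[OF decay(4)] left that])
  show ?thesis
    unfolding m_def[symmetric]
  proof (rule conjI)
    show "\<exists>\<delta>1 \<delta>2 \<delta>1' \<delta>2'. \<delta>1 > 0 \<and> \<delta>2 > 0 \<and> \<delta>1' > 0 \<and> \<delta>2' > 0 \<and>
        (\<forall>x. \<delta>1 * ux x \<le> ?P x \<and> ?P x \<le> \<delta>2 * ux x) \<and>
        (\<forall>x. \<delta>1' * \<psi> x \<le> P_adj r q w \<psi> x \<and> P_adj r q w \<psi> x \<le> \<delta>2' * \<psi> x)"
      by (rule exI[of _ \<delta>1], rule exI[of _ \<delta>2], rule exI[of _ \<delta>1'], rule exI[of _ \<delta>2'])
         (intro conjI allI \<delta>1 \<delta>2 \<delta>1' \<delta>2')
    show "\<exists>\<kappa>0>0. \<forall>h. weighted_sobolev 1 m h \<longrightarrow>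
        Var m h \<le> \<kappa>0 * (LINT x|weighted_measure m. (weak_deriv h x)\<^sup>2)"
      by (rule exI[of _ \<kappa>]) (intro conjI allI impI \<kappa> poincare)
  qed
qed

end
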